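(* For all $x,y>0$ such that $x\neq y$ and for all $\alpha\in(0,1)\cup(1,\infty)$, $$\lim_{z\to\infty}\zeta_{\alpha,z}(x,y)=\frac{\ln x-\ln y}{x-y},\qquad\text{where }\ \zeta_{\alpha,z}(x,y):=\frac{z}{\alpha(1-\alpha)}\left(\frac{x^{\frac{1-\alpha}{z}}-y^{\frac{1-\alpha}{z}}}{x-y}\right)\left(\frac{x^{\frac{\alpha}{z}}-y^{\frac{\alpha}{z}}}{x^{\frac1z}-y^{\frac1z}}\right).$$ Thus, for every second-order differentiable family $(\rho(\theta))_{\theta\in\mathbb{R}^L}$ of positive definite states on a finite-dimensional Hilbert space and for all $\alpha\in(0,1)\cup(1,\infty)$, $$\lim_{z\to\infty}I_{\alpha,z}(\theta)=I_{\mathrm{KM}}(\theta).$$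
   Context: For positive definite states (unit-trace operators) $\rho,\sigma$, $\alpha\in(0,1)\cup(1,\infty)$ and $z>0$: $D_{\alpha,z}(\rho\|\sigma):=\frac{1}{\alpha-1}\ln\mathrm{Tr}\big[(\sigma^{\frac{1-\alpha}{2z}}\rho^{\frac\alpha z}\sigma^{\frac{1-\alpha}{2z}})^z\big]$, and $D(\rho\|\sigma):=\mathrm{Tr}[\rho(\ln\rho-\ln\sigma)]$. The $\alpha$-$z$ information matrix has entries $[I_{\alpha,z}(\theta)]_{i,j}:=\frac1\alpha\left.\frac{\partial^2}{\partial\varepsilon_i\partial\varepsilon_j}D_{\alpha,z}(\rho(\theta)\|\rho(\theta+\varepsilon))\right|_{\varepsilon=0}$, and the Kubo--Mori information matrix has entries $[I_{\mathrm{KM}}(\theta)]_{i,j}:=\left.\frac{\partial^2}{\partial\varepsilon_i\partial\varepsilon_j}D(\rho(\theta)\|\rho(\theta+\varepsilon))\right|_{\varepsilon=0}$. *)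

theory Defs
  imports "HOL-Analysis.Analysis"
begin

section \<open>Operators on the Hilbert space of complex vectors\<close>

definition cadj :: "complex^'n^'m \<Rightarrow> complex^'m^'n" where
  "cadj A = (\<chi> i j. cnj (A $ j $ i))"

definition cinner :: "complex^'n \<Rightarrow> complex^'n \<Rightarrow> complex" where
  "cinner u v = (\<Sum>i\<in>UNIV. cnj (u $ i) * v $ i)"

definition unitary_mat :: "complex^'n^'n \<Rightarrow> bool" where
  "unitary_mat U \<longleftrightarrow> cadj U ** U = mat 1 \<and> U ** cadj U = mat 1"

definition rdiag :: "('n \<Rightarrow> real) \<Rightarrow> complex^'n^'n" where
  "rdiag d = (\<chi> i j. if i = j then complex_of_real (d i) else 0)"

definition positive_definite :: "complex^'n^'n \<Rightarrow> bool" where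
  "positive_definite A \<longleftrightarrow> cadj A = A \<and> (\<forall>v. v \<noteq> 0 \<longrightarrow> Re (cinner v (A *v v)) > 0)"

definition pd_state :: "complex^'n^'n \<Rightarrow> bool" where
  "pd_state A \<longleftrightarrow> positive_definite A \<and> trace A = 1"

text \<open>
  Functional calculus of a Hermitian matrix: apply \<open>f\<close> to the eigenvalues in a unitary
  diagonalization. By the lemma \<open>mat_fun_unitary_diag\<close> below the result does not depend on the
  diagonalization; \<open>mat_fun\<close> is unspecified on matrices that have none with real eigenvalues.
\<close>

definition mat_fun :: "(real \<Rightarrow> real) \<Rightarrow> complex^'n^'n \<Rightarrow> complex^'n^'n" where
  "mat_fun f A = (THE B. \<exists>U d. unitary_mat U \<and> A = U ** rdiag d ** cadj U \<and>
      B = U ** rdiag (\<lambda>i. f (d i)) ** cadj U)"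

definition mat_powr :: "complex^'n^'n \<Rightarrow> real \<Rightarrow> complex^'n^'n" where
  "mat_powr A s = mat_fun (\<lambda>t. t powr s) A"

definition mat_ln :: "complex^'n^'n \<Rightarrow> complex^'n^'n" where
  "mat_ln A = mat_fun ln A"

lemma rdiag_mult_left: "(rdiag d ** W) $ i $ j = complex_of_real (d i) * W $ i $ j"
  by (simp add: rdiag_def matrix_matrix_mult_def if_distrib[where f = "\<lambda>x. x * _"] cong: if_cong)

lemma rdiag_mult_right: "(W ** rdiag d) $ i $ j = W $ i $ j * complex_of_real (d j)"
  by (simp add: rdiag_def matrix_matrix_mult_def if_distrib[where f = "\<lambda>x. _ * x"] cong: if_cong)

lemma unitary_diag_unique:
  assumes U: "unitary_mat U" and V: "unitary_mat V"
    and eq: "U ** rdiag d ** cadj U = V ** rdiag e ** cadj V"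
  shows "U ** rdiag (\<lambda>i. f (d i)) ** cadj U = V ** rdiag (\<lambda>i. f (e i)) ** cadj V"
proof -
  define W where "W = cadj V ** U"
  have U1: "cadj U ** U = mat 1" "U ** cadj U = mat 1"
    and V1: "cadj V ** V = mat 1" "V ** cadj V = mat 1"
    using U V by (auto simp: unitary_mat_def)
  have "W ** rdiag d = cadj V ** (U ** rdiag d ** cadj U) ** U"
    unfolding W_def by (metis U1(1) matrix_mul_assoc matrix_mul_rid)
  also have "\<dots> = rdiag e ** W"
    unfolding eq W_def by (metis V1(1) matrix_mul_assoc matrix_mul_lid)
  finally have comm: "W ** rdiag d = rdiag e ** W" .
  have entry: "W $ i $ j * complex_of_real (d j) = complex_of_real (e i) * W $ i $ j" for i j
    using comm by (metis rdiag_mult_left rdiag_mult_right)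
  have "W $ i $ j * complex_of_real (f (d j)) = complex_of_real (f (e i)) * W $ i $ j" for i j
    using entry[of i j] by (cases "W $ i $ j = 0") (auto simp: mult.commute)
  then have "W ** rdiag (\<lambda>i. f (d i)) = rdiag (\<lambda>i. f (e i)) ** W"
    by (simp add: vec_eq_iff rdiag_mult_left rdiag_mult_right)
  then have "V ** (W ** rdiag (\<lambda>i. f (d i))) ** cadj U = V ** (rdiag (\<lambda>i. f (e i)) ** W) ** cadj U"
    by simp
  moreover have "V ** (W ** rdiag (\<lambda>i. f (d i))) ** cadj U = U ** rdiag (\<lambda>i. f (d i)) ** cadj U"
    unfolding W_def by (metis V1(2) matrix_mul_assoc matrix_mul_lid)
  moreover have "V ** (rdiag (\<lambda>i. f (e i)) ** W) ** cadj U = V ** rdiag (\<lambda>i. f (e i)) ** cadj V"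
    unfolding W_def by (metis U1(2) matrix_mul_assoc matrix_mul_rid)
  ultimately show ?thesis by simp
qed

lemma mat_fun_unitary_diag:
  assumes "unitary_mat U"
  shows "mat_fun f (U ** rdiag d ** cadj U) = U ** rdiag (\<lambda>i. f (d i)) ** cadj U"
  unfolding mat_fun_def
proof (rule the_equality)
  show "\<exists>V e. unitary_mat V \<and> U ** rdiag d ** cadj U = V ** rdiag e ** cadj V \<and>
      U ** rdiag (\<lambda>i. f (d i)) ** cadj U = V ** rdiag (\<lambda>i. f (e i)) ** cadj V"
    using assms by blast
next
  fix B
  assume "\<exists>V e. unitary_mat V \<and> U ** rdiag d ** cadj U = V ** rdiag e ** cadj V \<and>
      B = V ** rdiag (\<lambda>i. f (e i)) ** cadj V"
  then show "B = U ** rdiag (\<lambda>i. f (d i)) ** cadj U"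
    using unitary_diag_unique[OF assms] by metis
qed


section \<open>Relative entropies\<close>

text \<open>The traces below are real; \<open>Re\<close> only converts the type.\<close>

definition alpha_z_div :: "real \<Rightarrow> real \<Rightarrow> complex^'n^'n \<Rightarrow> complex^'n^'n \<Rightarrow> real" where
  "alpha_z_div \<alpha> z \<rho> \<sigma> = 1 / (\<alpha> - 1) * ln (Re (trace (mat_powr
      (mat_powr \<sigma> ((1 - \<alpha>) / (2 * z)) ** mat_powr \<rho> (\<alpha> / z) ** mat_powr \<sigma> ((1 - \<alpha>) / (2 * z))) z)))"

definition rel_entropy :: "complex^'n^'n \<Rightarrow> complex^'n^'n \<Rightarrow> real" where
  "rel_entropy \<rho> \<sigma> = Re (trace (\<rho> ** (mat_ln \<rho> - mat_ln \<sigma>)))"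


section \<open>Information matrices\<close>

definition partial_deriv :: "'l \<Rightarrow> (real^'l \<Rightarrow> real) \<Rightarrow> real^'l \<Rightarrow> real" where
  "partial_deriv i g x = deriv (\<lambda>t. g (x + t *\<^sub>R axis i 1)) 0"

definition alpha_z_info ::
    "real \<Rightarrow> real \<Rightarrow> (real^'l \<Rightarrow> complex^'n^'n) \<Rightarrow> real^'l \<Rightarrow> real^'l^'l" where
  "alpha_z_info \<alpha> z \<rho> \<theta> = (\<chi> i j. 1 / \<alpha> *
      partial_deriv i (partial_deriv j (\<lambda>\<epsilon>. alpha_z_div \<alpha> z (\<rho> \<theta>) (\<rho> (\<theta> + \<epsilon>)))) 0)"

definition kubo_mori_info :: "(real^'l \<Rightarrow> complex^'n^'n) \<Rightarrow> real^'l \<Rightarrow> real^'l^'l" where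
  "kubo_mori_info \<rho> \<theta> = (\<chi> i j.
      partial_deriv i (partial_deriv j (\<lambda>\<epsilon>. rel_entropy (\<rho> \<theta>) (\<rho> (\<theta> + \<epsilon>)))) 0)"

text \<open>Twice (Frechet) differentiable at every point; the second derivative need not be continuous.\<close>

definition twice_differentiable :: "('a::real_normed_vector \<Rightarrow> 'b::real_normed_vector) \<Rightarrow> bool" where
  "twice_differentiable f \<longleftrightarrow> (\<exists>f' :: 'a \<Rightarrow> 'a \<Rightarrow>\<^sub>L 'b.
      (\<forall>x. (f has_derivative blinfun_apply (f' x)) (at x)) \<and> (\<forall>x. f' differentiable (at x)))"

definition zeta_alpha_z :: "real \<Rightarrow> real \<Rightarrow> real \<Rightarrow> real \<Rightarrow> real" where
  "zeta_alpha_z \<alpha> z x y = z / (\<alpha> * (1 - \<alpha>)) *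
      ((x powr ((1 - \<alpha>) / z) - y powr ((1 - \<alpha>) / z)) / (x - y)) *
      ((x powr (\<alpha> / z) - y powr (\<alpha> / z)) / (x powr (1 / z) - y powr (1 / z)))"

end

theory Submission
  imports Defs "HOL-Real_Asymp.Real_Asymp"
begin

text \<open>
  Only first derivatives of matrix functions are needed. The first variation of both divergences in
  the second argument at \<open>\<sigma> = \<rho>\<close> is a multiple of the trace of the tangent vector, hence vanishes on
  states. Subtracting this identity at \<open>\<rho>(\<theta> + \<epsilon>)\<close> from the partial derivative at \<open>\<epsilon>\<close> writes the latter
  as \<open>Tr[P(\<epsilon>) G(\<epsilon>)]\<close> with \<open>P(0) = 0\<close>, where \<open>G\<close> is a continuous first derivative of a power or of
  the logarithm; the second derivative is therefore \<open>Tr[P'(0) G(0)]\<close>. In an eigenbasis of \<open>\<rho>(\<theta>)\<close> all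
  these derivatives are Schur products with divided differences (Daleckii--Krein), and the claim
  reduces to the limit of a scalar coefficient for each pair of eigenvalues.
\<close>

section \<open>Complex matrices\<close>

text \<open>Where eigenvalues of \<open>\<rho> (\<theta> + \<epsilon>)\<close> merge, its
  eigenvectors need not depend continuously on \<epsilon>, so eigenbases are never differentiated.
  Each matrix comes with an arbitrary eigenbasis of its own and two of them are compared through
  their overlaps; this is why double operator integrals are built from two diagonalizations. The
  same split Tr[P G] also keeps second derivatives of the family out of the final formula: the
  tangent vector enters G linearly and merely has to converge as \<epsilon> tends to 0. The
  coefficient of a pair of eigenvalues, \<open>alpha_z_coeff\<close>, stays in the form in which the
  derivatives produce it and its limit is taken directly. Repeated eigenvalues are then covered by
  the diagonal values of the divided differences.\<close>

lemma matrix_diff_ldistrib: "A ** (B - C) = A ** B - A ** (C :: 'a::comm_ring_1^'p^'n)"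
  by (simp add: vec_eq_iff matrix_matrix_mult_def right_diff_distrib sum_subtractf)

lemma matrix_diff_rdistrib: "(A - B) ** C = A ** C - B ** (C :: 'a::comm_ring_1^'p^'n)"
  by (simp add: vec_eq_iff matrix_matrix_mult_def left_diff_distrib sum_subtractf)

lemma matrix_add_rdistrib: "(A + B) ** C = A ** C + B ** (C :: 'a::comm_ring_1^'p^'n)"
  by (simp add: vec_eq_iff matrix_matrix_mult_def distrib_right sum.distrib)

lemma matrix_scaleR_ldistrib: "A ** (r *\<^sub>R B) = r *\<^sub>R (A ** (B :: complex^'p^'n))"
  by (simp add: vec_eq_iff matrix_matrix_mult_def scaleR_sum_right)

lemma matrix_scaleR_rdistrib: "(r *\<^sub>R A) ** B = r *\<^sub>R (A ** (B :: complex^'p^'n))"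
  by (simp add: vec_eq_iff matrix_matrix_mult_def scaleR_sum_right)

lemma trace_scaleR: "trace (r *\<^sub>R A) = r *\<^sub>R trace (A :: complex^'n^'n)"
  by (simp add: trace_def scaleR_sum_right)

lemma bounded_bilinear_matrix_mult:
  "bounded_bilinear ((**) :: complex^'n^'m \<Rightarrow> complex^'p^'n \<Rightarrow> complex^'p^'m)"
  unfolding bilinear_conv_bounded_bilinear[symmetric] bilinear_def
  by (auto intro!: linearI simp: matrix_add_ldistrib matrix_add_rdistrib
      matrix_scaleR_ldistrib matrix_scaleR_rdistrib)

lemma bounded_linear_Re_trace: "bounded_linear (\<lambda>A :: complex^'n^'n. Re (trace A))"
  unfolding linear_conv_bounded_linear[symmetric]
  by (auto intro!: linearI simp: trace_add trace_scaleR)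

section \<open>Adjoints, the inner product and unitary matrices\<close>

lemma cadj_cadj [simp]: "cadj (cadj A) = A"
  by (simp add: cadj_def vec_eq_iff)

lemma cadj_mult: "cadj (A ** B) = cadj B ** cadj A"
  by (simp add: cadj_def vec_eq_iff matrix_matrix_mult_def mult.commute)

lemma cadj_rdiag [simp]: "cadj (rdiag d) = rdiag d"
  by (auto simp add: cadj_def rdiag_def vec_eq_iff)

lemma cadj_mat1 [simp]: "cadj (mat 1) = mat 1"
  by (auto simp: cadj_def mat_def vec_eq_iff)

lemma cinner_cadj: "cinner (cadj A *v u) v = cinner u (A *v v)"
  by (simp add: cinner_def cadj_def matrix_vector_mult_def sum_distrib_left sum_distrib_right mult.assoc
      mult.left_commute) (subst sum.swap, simp add: mult_ac)

lemma cinner_commute: "cinner v u = cnj (cinner u v)"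
  by (simp add: cinner_def mult.commute)

lemma cinner_add_left: "cinner (u + v) w = cinner u w + cinner v w"
  and cinner_add_right: "cinner w (u + v) = cinner w u + cinner w v"
  and cinner_diff_left: "cinner (u - v) w = cinner u w - cinner v w"
  and cinner_diff_right: "cinner w (u - v) = cinner w u - cinner w v"
  and cinner_scale_left: "cinner (c *s u) w = cnj c * cinner u w"
  and cinner_scale_right: "cinner w (c *s u) = c * cinner w u"
  by (simp_all add: cinner_def algebra_simps sum.distrib sum_distrib_left sum_subtractf)

lemma cadj_mult_entry: "(cadj U ** V) $ i $ j = cinner (column i U) (column j V)"
  by (simp add: matrix_matrix_mult_def cadj_def cinner_def column_def)

lemma column_mult: "column j (A ** U) = A *v column j (U :: complex^'p^'n)"
  by (simp add: vec_eq_iff column_def matrix_matrix_mult_def matrix_vector_mult_def)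

text \<open>Orthonormal columns make \<open>cadj U\<close> a left inverse, and for square matrices a
  one-sided inverse is two-sided.\<close>

lemma unitary_matI:
  assumes "\<And>i j. cinner (column i U) (column j U) = (if i = j then 1 else 0)"
  shows "unitary_mat (U :: complex^'n^'n)"
proof -
  have "cadj U ** U = mat 1"
    using assms by (simp add: vec_eq_iff cadj_mult_entry mat_def)
  then show ?thesis
    unfolding unitary_mat_def using matrix_left_right_inverse by blast
qed

lemma unitary_matD:
  assumes "unitary_mat U"
  shows "cadj U ** U = mat 1" "U ** cadj U = mat 1"
    "\<And>i j. cinner (column i U) (column j U) = (if i = j then 1 else 0)"
  using assms by (auto simp: unitary_mat_def cadj_mult_entry[symmetric] mat_def)

text \<open>The spectator \<open>X\<close> lets adjacent factors \<open>U\<close> and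
  \<open>cadj U\<close> cancel inside longer products, for either association.\<close>

lemma cancel_cadj_unitary:
  assumes "unitary_mat (U :: complex^'n^'n)"
  shows "cadj U ** (U ** X) = X" "U ** (cadj U ** X) = X" "X ** cadj U ** U = X" "X ** U ** cadj U = X"
  using unitary_matD(1,2)[OF assms]
  by (simp_all add: matrix_mul_assoc) (simp_all flip: matrix_mul_assoc)

lemma unitary_mat_cadj: "unitary_mat U \<Longrightarrow> unitary_mat (cadj U)"
  by (simp add: unitary_mat_def)

lemma unitary_mat_mult: "unitary_mat U \<Longrightarrow> unitary_mat V \<Longrightarrow> unitary_mat (U ** V)"
  unfolding unitary_mat_def cadj_mult
  by (metis cancel_cadj_unitary(1,4) unitary_mat_def matrix_mul_assoc)

section \<open>Bounds between entries and norms\<close>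

lemma unitary_col_norm:
  assumes "unitary_mat U"
  shows "(\<Sum>k\<in>UNIV. (cmod (U $ k $ l))\<^sup>2) = 1"
proof -
  have "complex_of_real (\<Sum>k\<in>UNIV. (cmod (U $ k $ l))\<^sup>2) = (cadj U ** U) $ l $ l"
    by (simp add: matrix_matrix_mult_def cadj_def complex_norm_square mult.commute del: of_real_power)
  also have "\<dots> = 1"
    using unitary_matD(1)[OF assms] by (simp add: mat_def)
  finally show ?thesis using of_real_eq_1_iff by blast
qed

lemma unitary_entry_le_1:
  assumes "unitary_mat U"
  shows "cmod (U $ k $ l) \<le> 1"
proof -
  have "(cmod (U $ k $ l))\<^sup>2 \<le> (\<Sum>k\<in>UNIV. (cmod (U $ k $ l))\<^sup>2)"
    by (rule member_le_sum) auto
  then show ?thesis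
    unfolding unitary_col_norm[OF assms] using power_le_one_iff[of "cmod (U $ k $ l)" 2]
    by (simp add: abs_square_le_1)
qed

lemma matrix_entry_le_norm: "cmod (A $ i $ j) \<le> norm (A :: complex^'n^'m)"
  by (meson Finite_Cartesian_Product.norm_nth_le order_trans)

lemma matrix_norm_le_sum: "norm A \<le> (\<Sum>i\<in>UNIV. \<Sum>j\<in>UNIV. cmod ((A :: complex^'n^'m) $ i $ j))"
proof -
  have "norm A \<le> (\<Sum>i\<in>UNIV. norm (A $ i))"
    unfolding norm_vec_def[of A] by (rule L2_set_le_sum) simp
  also have "\<dots> \<le> (\<Sum>i\<in>UNIV. \<Sum>j\<in>UNIV. cmod (A $ i $ j))"
    by (rule sum_mono) (simp add: norm_vec_def L2_set_le_sum)
  finally show ?thesis .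
qed

text \<open>The norm is the Euclidean norm of all entries. Dimension factors are estimated
  generously here and below, because only the finiteness of the constants matters.\<close>

lemma matrix_norm_le:
  assumes "\<And>i j. cmod ((A :: complex^'n^'m) $ i $ j) \<le> c"
  shows "norm A \<le> real CARD('m) * real CARD('n) * c"
proof -
  have "(\<Sum>i\<in>UNIV. \<Sum>j\<in>UNIV. cmod (A $ i $ j)) \<le> (\<Sum>i\<in>(UNIV::'m set). \<Sum>j\<in>(UNIV::'n set). c)"
    by (intro sum_mono assms)
  also have "\<dots> = real CARD('m) * real CARD('n) * c" by simp
  finally show ?thesis using matrix_norm_le_sum order_trans by blast
qed

section \<open>The spectral theorem\<close>

lemma bounded_linear_cadj: "bounded_linear (cadj :: complex^'n^'m \<Rightarrow> complex^'m^'n)"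
  unfolding linear_conv_bounded_linear[symmetric]
  by (rule linearI) (simp_all add: cadj_def vec_eq_iff)

lemmas continuous_on_cadj [continuous_intros] = bounded_linear.continuous_on[OF bounded_linear_cadj]
lemmas continuous_on_matrix_mult [continuous_intros] =
  bounded_bilinear.continuous_on[OF bounded_bilinear_matrix_mult]

text \<open>Entries are bounded by 1 and the defining equation is closed. Compactness supplies the
  maximiser from which an eigenbasis is read off.\<close>

lemma compact_unitary_mat: "compact {U :: complex^'n^'n. unitary_mat U}"
  unfolding compact_eq_bounded_closed
proof
  have "norm U \<le> real CARD('n) * real CARD('n) * 1" if "unitary_mat U" for U :: "complex^'n^'n"
    by (rule matrix_norm_le) (rule unitary_entry_le_1[OF that])
  then show "bounded {U :: complex^'n^'n. unitary_mat U}"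
    unfolding bounded_iff by blast
  have "closed {U :: complex^'n^'n. cadj U ** U = mat 1}"
    by (intro closed_Collect_eq continuous_intros)
  moreover have "{U :: complex^'n^'n. cadj U ** U = mat 1} = {U. unitary_mat U}"
    by (auto simp: unitary_mat_def matrix_left_right_inverse)
  ultimately show "closed {U :: complex^'n^'n. unitary_mat U}" by simp
qed

lemma hermitian_cinner:
  assumes "cadj A = A"
  shows "cinner v (A *v u) = cnj (cinner u (A *v v))"
  by (metis assms cinner_cadj cinner_commute)

section \<open>Plane rotations of orthonormal columns\<close>

definition plane_rotation :: "'n \<Rightarrow> 'n \<Rightarrow> complex \<Rightarrow> real \<Rightarrow> complex^'n^'n \<Rightarrow> complex^'n^'n" where
  "plane_rotation k l w t U = (\<chi> i m.
      if m = k then of_real (cos t) * U $ i $ k + of_real (sin t) * w * U $ i $ l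
      else if m = l then - of_real (sin t) * cnj w * U $ i $ k + of_real (cos t) * U $ i $ l
      else U $ i $ m)"

lemma column_plane_rotation:
  assumes "k \<noteq> l"
  shows "column k (plane_rotation k l w t U) =
      of_real (cos t) *s column k U + (of_real (sin t) * w) *s column l U"
    "column l (plane_rotation k l w t U) =
      (- of_real (sin t) * cnj w) *s column k U + of_real (cos t) *s column l U"
    "m \<noteq> k \<Longrightarrow> m \<noteq> l \<Longrightarrow> column m (plane_rotation k l w t U) = column m U"
  using assms by (simp_all add: column_def plane_rotation_def vec_eq_iff)

lemma unitary_plane_rotation:
  assumes "unitary_mat U" "k \<noteq> l" "cmod w = 1"
  shows "unitary_mat (plane_rotation k l w t U)"
proof (rule unitary_matI)
  note u = unitary_matD(3)[OF assms(1)]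
  note cols = column_plane_rotation[OF assms(2)]
  define s c where "s = complex_of_real (sin t)" and "c = complex_of_real (cos t)"
  have w: "w * cnj w = 1"
    using assms(3) by (metis complex_norm_square of_real_1 power_one)
  have cs: "c * c + s * s = 1"
    unfolding s_def c_def
    by (metis cos_squared_eq diff_add_cancel of_real_1 of_real_add of_real_mult power2_eq_square)
  have cnj: "cnj s = s" "cnj c = c"
    by (simp_all add: s_def c_def)
  have ws: "s * cnj w * (s * w) = s * s" "s * w * (s * cnj w) = s * s"
    using w by (metis mult.assoc mult.left_commute mult.right_neutral)+
  fix i j
  consider "i = k" | "i = l" | "i \<noteq> k" "i \<noteq> l" by blast
  then show "cinner (column i (plane_rotation k l w t U)) (column j (plane_rotation k l w t U)) =
      (if i = j then 1 else 0)"
  proof cases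
    case 1
    then show ?thesis
      using assms(2) cs unfolding s_def[symmetric] c_def[symmetric]
      by (cases "j = k"; cases "j = l")
        (simp_all add: cols cinner_add_left cinner_add_right cinner_diff_left
          cinner_diff_right
          cinner_scale_left cinner_scale_right u
          cnj ws flip: s_def c_def)
  next
    case 2
    then show ?thesis
      using assms(2) cs unfolding s_def[symmetric] c_def[symmetric]
      by (cases "j = k"; cases "j = l")
        (simp_all add: cols cinner_add_left cinner_add_right cinner_diff_left
          cinner_diff_right
          cinner_scale_left cinner_scale_right u
          cnj ws add.commute flip: s_def c_def)
  next
    case 3
    then show ?thesis
      using assms(2)
      by (cases "j = k"; cases "j = l")
        (simp_all add: cols cinner_add_left cinner_add_right cinner_diff_left
          cinner_diff_right
          cinner_scale_left cinner_scale_right u)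
  qed
qed

text \<open>Since \<open>A\<close> is Hermitian, the two mixed terms are complex conjugates and add
  up to twice a real part; \<open>cmod w = 1\<close> removes the phase from the squares.\<close>

lemma quadratic_form_plane_rotation:
  fixes A U :: "complex^'n^'n" and t :: real
  assumes "cadj A = A" "k \<noteq> l" "cmod w = 1"
  defines "u \<equiv> \<lambda>m. column m U" and "v \<equiv> \<lambda>m. column m (plane_rotation k l w t U)"
  defines "q \<equiv> \<lambda>x. Re (cinner x (A *v x))" and "r \<equiv> Re (w * cinner (column k U) (A *v column l U))"
  shows "q (v k) = (cos t)\<^sup>2 * q (u k) + (sin t)\<^sup>2 * q (u l) + 2 * cos t * sin t * r"
    and "q (v l) = (sin t)\<^sup>2 * q (u k) + (cos t)\<^sup>2 * q (u l) - 2 * cos t * sin t * r"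
proof -
  note cols = column_plane_rotation[OF assms(2)]
  have sw: "cinner (column l U) (A *v column k U) = cnj (cinner (column k U) (A *v column l U))"
    by (rule hermitian_cinner[OF assms(1)])
  have re: "Im (cinner x (A *v x)) = 0" for x
    using hermitian_cinner[OF assms(1), of x x] by (metis cnj.simps(2) equal_neg_zero)
  have w: "Re w * Re w + Im w * Im w = 1"
    using assms(3) by (metis cmod_power2 power2_eq_square power_one)
  note exp = matrix_vector_right_distrib matrix_vector_mult_diff_distrib vec.scale
      cinner_add_left cinner_add_right cinner_diff_left cinner_diff_right
      cinner_scale_left cinner_scale_right sw
  show "q (v k) = (cos t)\<^sup>2 * q (u k) + (sin t)\<^sup>2 * q (u l) + 2 * cos t * sin t * r"
    unfolding q_def u_def v_def r_def cols
    by (simp add: exp re) (use w in algebra)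
  show "q (v l) = (sin t)\<^sup>2 * q (u k) + (cos t)\<^sup>2 * q (u l) - 2 * cos t * sin t * r"
    unfolding q_def u_def v_def r_def cols
    by (simp add: exp re) (use w in algebra)
qed

lemma conj_entry: "(cadj U ** A ** V) $ i $ j = cinner (column i U) (A *v column j V)"
  by (simp add: cadj_mult_entry column_mult flip: matrix_mul_assoc)

text \<open>With pairwise distinct weights \<open>c\<close>, stationarity of the weighted trace of \<open>U\<^sup>* A U\<close> under
  plane rotations forces the off-diagonal entries to vanish.\<close>

theorem hermitian_unitary_diagonalization:
  fixes A :: "complex^'n^'n"
  assumes "cadj A = A"
  obtains U d where "unitary_mat U" "A = U ** rdiag d ** cadj U"
proof -
  obtain c :: "'n \<Rightarrow> nat" where c: "inj c"
    using finite_imp_inj_to_nat_seg[OF finite[of UNIV]] by blast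
  define q where "q x = Re (cinner x (A *v x))" for x
  define f where "f U = (\<Sum>m\<in>UNIV. real (c m) * Re ((cadj U ** A ** U) $ m $ m))" for U
  have f_alt: "f U = (\<Sum>m\<in>UNIV. real (c m) * q (column m U))" for U
    unfolding f_def q_def conj_entry ..
  have "continuous_on {U. unitary_mat U} f"
    unfolding f_def by (intro continuous_intros)
  moreover have "(mat 1 :: complex^'n^'n) \<in> {U. unitary_mat U}"
    by (simp add: unitary_mat_def)
  ultimately obtain U where U: "unitary_mat U" and max: "\<And>V. unitary_mat V \<Longrightarrow> f V \<le> f U"
    using continuous_attains_sup[OF compact_unitary_mat, of f] by blast
  have stationary: "Re (w * cinner (column k U) (A *v column l U)) = 0"
    if kl: "k \<noteq> l" and w: "cmod w = 1" for k l w
  proof -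
    define r where "r = Re (w * cinner (column k U) (A *v column l U))"
    define a b where "a = q (column k U)" and "b = q (column l U)"
    define g where "g t = f (plane_rotation k l w t U)" for t
    \<comment> \<open>\<open>C\<close> collects the columns that the rotation leaves fixed.\<close>
    define C where "C = f U - real (c k) * a - real (c l) * b"
    have g: "g t = C + real (c k) * ((cos t)\<^sup>2 * a + (sin t)\<^sup>2 * b + 2 * cos t * sin t * r) +
        real (c l) * ((sin t)\<^sup>2 * a + (cos t)\<^sup>2 * b - 2 * cos t * sin t * r)" for t
    proof -
      let ?V = "plane_rotation k l w t U"
      have "g t - f U = (\<Sum>m\<in>UNIV. real (c m) * (q (column m ?V) - q (column m U)))"
        by (simp add: g_def f_alt right_diff_distrib sum_subtractf)
      also have "\<dots> = (\<Sum>m\<in>{k,l}. real (c m) * (q (column m ?V) - q (column m U)))"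
        by (rule sum.mono_neutral_right) (auto simp: column_plane_rotation(3)[OF kl])
      also have "\<dots> = real (c k) * (q (column k ?V) - a) + real (c l) * (q (column l ?V) - b)"
        using kl by (simp add: a_def b_def)
      finally show ?thesis
        using quadratic_form_plane_rotation[OF assms kl w, of t U]
        by (simp add: C_def a_def b_def r_def q_def algebra_simps)
    qed
    \<comment> \<open>At 0 the squares of sine and cosine have derivative 0, so only the mixed terms
      contribute. Their weights differ by injectivity of \<open>c\<close>, hence a maximum at 0
      forces \<open>r = 0\<close>.\<close>
    have "(g has_real_derivative 2 * r * (real (c k) - real (c l))) (at 0)"
      unfolding g by (auto intro!: derivative_eq_intros simp: algebra_simps)
    moreover have "plane_rotation k l w 0 U = U"
      by (simp add: plane_rotation_def vec_eq_iff)
    then have "g t \<le> g 0" for t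
      using max[OF unitary_plane_rotation[OF U kl w]] by (simp add: g_def)
    ultimately have "2 * r * (real (c k) - real (c l)) = 0"
      using DERIV_local_max[of g "2 * r * (real (c k) - real (c l))" 0 1] by simp
    then show ?thesis
      using kl c by (auto simp: r_def inj_eq)
  qed
  define d where "d m = q (column m U)" for m
  \<comment> \<open>The phases 1 and \<i> kill the real and the imaginary part of the off-diagonal
    entry.\<close>
  have off: "cinner (column k U) (A *v column l U) = 0" if "k \<noteq> l" for k l
    using stationary[OF that, of 1] stationary[OF that, of \<i>] by (simp add: complex_eq_iff)
  have diag: "cinner (column k U) (A *v column k U) = complex_of_real (d k)" for k
    using hermitian_cinner[OF assms, of "column k U" "column k U"]
    by (simp add: complex_eq_iff d_def q_def)
  have "cadj U ** A ** U = rdiag d"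
    by (auto simp: vec_eq_iff conj_entry rdiag_def off diag)
  then have "A = U ** rdiag d ** cadj U"
    by (metis U cancel_cadj_unitary(2,4) matrix_mul_assoc)
  with U show ?thesis by (rule that)
qed

text \<open>In the coordinates \<open>cadj U *v v\<close> the quadratic form is a sum of squared
  moduli with weights \<open>d i\<close>.\<close>

lemma positive_definite_unitary_diag:
  assumes "unitary_mat U"
  shows "positive_definite (U ** rdiag d ** cadj U) \<longleftrightarrow> (\<forall>i. d i > 0)"
proof -
  have herm: "cadj (U ** rdiag d ** cadj U) = U ** rdiag d ** cadj U"
    by (simp add: cadj_mult matrix_mul_assoc)
  have form: "Re (cinner v ((U ** rdiag d ** cadj U) *v v)) =
      (\<Sum>i\<in>UNIV. d i * (cmod ((cadj U *v v) $ i))\<^sup>2)" for v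
  proof -
    have "cinner v ((U ** rdiag d ** cadj U) *v v) = cinner (cadj U *v v) (rdiag d *v (cadj U *v v))"
      by (simp add: cinner_cadj matrix_vector_mul_assoc matrix_mul_assoc)
    also have "\<dots> = of_real (\<Sum>i\<in>UNIV. d i * (cmod ((cadj U *v v) $ i))\<^sup>2)"
      by (simp add: cinner_def matrix_vector_mult_def rdiag_def complex_norm_square
          if_distrib[where f = "\<lambda>x. x * _"] mult_ac del: of_real_power cong: if_cong)
    finally show ?thesis by simp
  qed
  show ?thesis
  proof
    assume pd: "positive_definite (U ** rdiag d ** cadj U)"
    show "\<forall>i. d i > 0"
    proof
      fix i
      \<comment> \<open>Test vector: the eigenvector \<open>U *v axis i 1\<close>, at which the form
        takes the value \<open>d i\<close>.\<close>
      have e: "cadj U *v (U *v axis i 1) = axis i 1"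
        by (simp add: matrix_vector_mul_assoc unitary_matD(1)[OF assms])
      then have "U *v axis i 1 \<noteq> 0"
        by (metis axis_eq_0_iff matrix_vector_mult_0_right zero_neq_one)
      then have "(\<Sum>j\<in>UNIV. d j * (cmod (axis i 1 $ j))\<^sup>2) > 0"
        using pd e unfolding positive_definite_def form by metis
      then show "d i > 0"
        by (simp add: axis_def if_distrib[where f = "\<lambda>x. _ * x"]
              if_distrib[where f = "\<lambda>x. (cmod x)\<^sup>2"] cong: if_cong)
    qed
  next
    assume d: "\<forall>i. d i > 0"
    have "(\<Sum>i\<in>UNIV. d i * (cmod ((cadj U *v v) $ i))\<^sup>2) > 0" if "v \<noteq> 0" for v
    proof -
      have "U *v (cadj U *v v) = v"
        by (simp add: matrix_vector_mul_assoc unitary_matD(2)[OF assms])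
      then have "cadj U *v v \<noteq> 0"
        using that by (metis matrix_vector_mult_0_right)
      then obtain i where "(cadj U *v v) $ i \<noteq> 0" by (auto simp: vec_eq_iff)
      then show ?thesis
        using d by (intro sum_pos2[where i = i]) (auto simp: less_imp_le)
    qed
    then show "positive_definite (U ** rdiag d ** cadj U)"
      unfolding positive_definite_def form using herm by blast
  qed
qed

lemma positive_definite_diagonalization:
  assumes "positive_definite A"
  obtains U d where "unitary_mat U" "A = U ** rdiag d ** cadj U" "\<And>i. d i > 0"
proof -
  obtain U d where U: "unitary_mat U" "A = U ** rdiag d ** cadj U"
    using assms hermitian_unitary_diagonalization unfolding positive_definite_def by metis
  with assms have "\<forall>i. d i > 0"
    by (simp add: positive_definite_unitary_diag)
  with U show ?thesis using that by blast
qed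

lemma positive_definite_mat_fun:
  assumes "positive_definite A" "\<And>x. x > 0 \<Longrightarrow> f x > 0"
  shows "positive_definite (mat_fun f A)"
proof -
  obtain U d where "unitary_mat U" "A = U ** rdiag d ** cadj U" "\<And>i. d i > 0"
    using positive_definite_diagonalization[OF assms(1)] by metis
  then show ?thesis
    using assms(2) by (simp add: mat_fun_unitary_diag positive_definite_unitary_diag)
qed

text \<open>The form of the product at \<open>v\<close> is the form of \<open>A\<close> at
  \<open>S *v v\<close>, and \<open>S\<close> has trivial kernel. This places the inner operator of
  \<open>alpha_z_div\<close> in the domain where matrix functions are differentiated.\<close>

lemma positive_definite_sandwich:
  assumes A: "positive_definite A" and S: "positive_definite S"
  shows "positive_definite (S ** A ** S)"
  unfolding positive_definite_def
proof (intro conjI allI impI)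
  have herm: "cadj A = A" "cadj S = S"
    using assms by (auto simp: positive_definite_def)
  then show "cadj (S ** A ** S) = S ** A ** S"
    by (simp add: cadj_mult matrix_mul_assoc)
  fix v :: "complex^'a" assume "v \<noteq> 0"
  then have "S *v v \<noteq> 0"
    using S by (auto simp: positive_definite_def cinner_def)
  moreover have "cinner v ((S ** A ** S) *v v) = cinner (S *v v) (A *v (S *v v))"
    using cinner_cadj[of S v "A *v (S *v v)"] herm
    by (simp add: matrix_vector_mul_assoc matrix_mul_assoc)
  ultimately show "Re (cinner v ((S ** A ** S) *v v)) > 0"
    using A by (simp add: positive_definite_def)
qed

section \<open>Double operator integrals\<close>

text \<open>The diagonal value is an explicit parameter, so purely algebraic identities such as
  \<open>mat_fun_diff\<close> can be stated without any differentiability of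
  \<open>f\<close>.\<close>

definition divided_difference :: "(real \<Rightarrow> real) \<Rightarrow> (real \<Rightarrow> real) \<Rightarrow> real \<Rightarrow> real \<Rightarrow> real" where
  "divided_difference f f' x y = (if x = y then f' x else (f x - f y) / (x - y))"

text \<open>Bounds are asked for only on squares away from 0, where powers and \<open>ln\<close> may
  be singular. The spectra of all matrices close to a positive definite one lie in a common such
  interval.\<close>

definition locally_lipschitz_pos :: "(real \<Rightarrow> real \<Rightarrow> real) \<Rightarrow> bool" where
  "locally_lipschitz_pos F \<longleftrightarrow> (\<forall>a b. 0 < a \<longrightarrow> (\<exists>L\<ge>0. \<forall>x\<in>{a..b}. \<forall>x'\<in>{a..b}. \<forall>y\<in>{a..b}. \<forall>y'\<in>{a..b}.
      \<bar>F x y - F x' y'\<bar> \<le> L * (\<bar>x - x'\<bar> + \<bar>y - y'\<bar>)))"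

text \<open>The divided difference at \<open>x\<close>, \<open>y\<close> is the integral of
  \<open>f'\<close> over the segment from \<open>y\<close> to \<open>x\<close>, parametrized by
  [0,1]. This formula includes the diagonal, so the Lipschitz constant of \<open>f'\<close>, a bound
  on \<open>f''\<close>, passes to the divided difference without distinguishing cases.\<close>

lemma locally_lipschitz_pos_divided_difference:
  assumes f: "\<And>x. x > 0 \<Longrightarrow> (f has_real_derivative f' x) (at x)"
    and f': "\<And>x. x > 0 \<Longrightarrow> (f' has_real_derivative f'' x) (at x)"
    and f'': "continuous_on {0<..} f''"
  shows "locally_lipschitz_pos (divided_difference f f')"
  unfolding locally_lipschitz_pos_def
proof (intro allI impI)
  fix a b :: real assume a: "0 < a"
  have "continuous_on {a..b} f''"
    using f'' by (rule continuous_on_subset) (use a in auto)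
  then have "bounded (f'' ` {a..b})"
    using compact_continuous_image compact_imp_bounded by blast
  then obtain M where M: "M > 0" "\<And>x. x \<in> {a..b} \<Longrightarrow> \<bar>f'' x\<bar> \<le> M"
    unfolding bounded_pos by (auto simp: real_norm_def)
  have lip: "\<bar>f' x - f' y\<bar> \<le> M * \<bar>x - y\<bar>" if "x \<in> {a..b}" "y \<in> {a..b}" for x y
  proof -
    have "norm (f' x - f' y) \<le> M * norm (x - y)"
      by (rule field_differentiable_bound[where S = "{a..b}" and f' = f''])
        (simp_all add: has_field_derivative_at_within[OF f'] order.strict_trans2[OF a] M that[simplified])
    then show ?thesis by (simp add: real_norm_def)
  qed
  have mem: "t * x + (1 - t) * y \<in> {a..b}" if "x \<in> {a..b}" "y \<in> {a..b}" "t \<in> {0..1}" for x y t :: real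
    using convexD[OF convex_real_interval(5)[of a b] that(1,2), of t "1 - t"] that(3) by simp
  have int: "((\<lambda>t. f' (t * x + (1 - t) * y)) has_integral divided_difference f f' x y) {0..1}"
    if x: "x \<in> {a..b}" and y: "y \<in> {a..b}" for x y
  proof (cases "x = y")
    case True
    moreover have "t * y + (1 - t) * y = y" for t :: real
      by (simp add: left_diff_distrib)
    ultimately show ?thesis
      using has_integral_const_real[of "f' y" 0 1] by (simp add: divided_difference_def)
  next
    case False
    have "((\<lambda>t. f' (t * x + (1 - t) * y) * (x - y)) has_integral
        f (1 * x + (1 - 1) * y) - f (0 * x + (1 - 0) * y)) {0..1}"
    proof (rule fundamental_theorem_of_calculus)
      fix t :: real assume t: "t \<in> {0..1}"
      have pos: "t * x + (1 - t) * y > 0" using mem[OF x y t] a by simp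
      have "((\<lambda>t. f (t * x + (1 - t) * y)) has_real_derivative f' (t * x + (1 - t) * y) * (x - y)) (at t)"
        by (rule DERIV_chain2[where f = f and g = "\<lambda>t. t * x + (1 - t) * y", OF f[OF pos]])
          (auto intro!: derivative_eq_intros)
      then show "((\<lambda>t. f (t * x + (1 - t) * y)) has_vector_derivative f' (t * x + (1 - t) * y) * (x - y))
          (at t within {0..1})"
        by (simp add: has_real_derivative_iff_has_vector_derivative has_vector_derivative_at_within)
    qed simp
    from has_integral_divide[OF this, of "x - y"] show ?thesis
      using False by (simp add: divided_difference_def)
  qed
  show "\<exists>L\<ge>0. \<forall>x\<in>{a..b}. \<forall>x'\<in>{a..b}. \<forall>y\<in>{a..b}. \<forall>y'\<in>{a..b}.
      \<bar>divided_difference f f' x y - divided_difference f f' x' y'\<bar> \<le> L * (\<bar>x - x'\<bar> + \<bar>y - y'\<bar>)"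
  proof (intro exI[of _ M] conjI ballI)
    fix x x' y y' assume mems: "x \<in> {a..b}" "x' \<in> {a..b}" "y \<in> {a..b}" "y' \<in> {a..b}"
    have "norm (divided_difference f f' x y - divided_difference f f' x' y')
        \<le> M * (\<bar>x - x'\<bar> + \<bar>y - y'\<bar>) * measure lborel (cbox 0 (1::real))"
    proof (rule has_integral_bound)
      show "((\<lambda>t. f' (t * x + (1 - t) * y) - f' (t * x' + (1 - t) * y')) has_integral
          divided_difference f f' x y - divided_difference f f' x' y') (cbox 0 1)"
        using has_integral_diff[OF int int] mems by simp
      fix t :: real assume "t \<in> cbox 0 1"
      then have t: "t \<in> {0..1}" by simp
      have "\<bar>f' (t * x + (1 - t) * y) - f' (t * x' + (1 - t) * y')\<bar>
          \<le> M * \<bar>(t * x + (1 - t) * y) - (t * x' + (1 - t) * y')\<bar>"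
        by (intro lip mem mems t)
      also have "(t * x + (1 - t) * y) - (t * x' + (1 - t) * y') = t * (x - x') + (1 - t) * (y - y')"
        by (simp add: algebra_simps)
      also have "\<bar>\<dots>\<bar> \<le> 1 * \<bar>x - x'\<bar> + 1 * \<bar>y - y'\<bar>"
        by (rule order_trans[OF abs_triangle_ineq], unfold abs_mult)
          (intro add_mono mult_right_mono; use t in auto)
      finally show "norm (f' (t * x + (1 - t) * y) - f' (t * x' + (1 - t) * y'))
          \<le> M * (\<bar>x - x'\<bar> + \<bar>y - y'\<bar>)"
        using M(1) by (simp add: mult_left_mono)
    qed (use M in simp)
    then show "\<bar>divided_difference f f' x y - divided_difference f f' x' y'\<bar>
        \<le> M * (\<bar>x - x'\<bar> + \<bar>y - y'\<bar>)"
      by simp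
  qed (use M in simp)
qed

text \<open>The double operator integral with symbol \<open>F\<close> for the matrices \<open>U ** rdiag d ** cadj U\<close>
  and \<open>V ** rdiag e ** cadj V\<close>.\<close>

definition double_op :: "(real \<Rightarrow> real \<Rightarrow> real) \<Rightarrow> complex^'n^'n \<Rightarrow> ('n \<Rightarrow> real) \<Rightarrow>
    complex^'n^'n \<Rightarrow> ('n \<Rightarrow> real) \<Rightarrow> complex^'n^'n \<Rightarrow> complex^'n^'n" where
  "double_op F U d V e H =
    U ** (\<chi> k l. of_real (F (d k) (e l)) * (cadj U ** H ** V) $ k $ l) ** cadj V"

section \<open>Comparing two eigenbases\<close>

lemma unitary_sandwich_entry_le:
  fixes U V :: "complex^'n^'n"
  assumes "unitary_mat U" "unitary_mat V"
  shows "cmod ((U ** H ** V) $ i $ j) \<le> (real CARD('n))\<^sup>2 * norm H"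
proof -
  have "cmod ((U ** H ** V) $ i $ j) = cmod (\<Sum>b\<in>UNIV. \<Sum>a\<in>UNIV. U $ i $ a * H $ a $ b * V $ b $ j)"
    by (simp add: matrix_matrix_mult_def sum_distrib_right)
  also have "\<dots> \<le> (\<Sum>b\<in>(UNIV::'n set). \<Sum>a\<in>(UNIV::'n set). 1 * norm H * 1)"
    by (intro sum_norm_le, unfold norm_mult)
      (intro mult_mono unitary_entry_le_1 assms matrix_entry_le_norm; simp)
  also have "\<dots> = (real CARD('n))\<^sup>2 * norm H"
    by (simp add: power2_eq_square)
  finally show ?thesis .
qed

lemma unitary_sandwich_norm_le:
  fixes U V :: "complex^'n^'n"
  assumes "unitary_mat U" "unitary_mat V"
  shows "norm (U ** H ** V) \<le> (real CARD('n))^4 * norm H"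
  using matrix_norm_le[of "U ** H ** V", OF unitary_sandwich_entry_le[OF assms]]
  by (simp add: power4_eq_xxxx power2_eq_square mult.assoc)

text \<open>In \<open>cadj U' ** (A - A') ** U\<close> the matrix \<open>A\<close> meets its
  eigenvectors on the right and \<open>A'\<close> its own on the left. This identity replaces the
  perturbation theory of eigenvectors: it yields the orthogonality of eigenspaces, the stability of
  the spectrum and the Lipschitz bound for \<open>double_op\<close>.\<close>

lemma eigen_gap_entry:
  assumes U: "unitary_mat U" and U': "unitary_mat U'"
    and "A = U ** rdiag d ** cadj U" "A' = U' ** rdiag d' ** cadj U'"
  shows "of_real (d k - d' m) * (cadj U' ** U) $ m $ k = (cadj U' ** (A - A') ** U) $ m $ k"
proof -
  have "cadj U' ** (A - A') ** U = (cadj U' ** U) ** rdiag d - rdiag d' ** (cadj U' ** U)"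
    by (simp add: assms(3,4) matrix_diff_ldistrib matrix_diff_rdistrib
        cancel_cadj_unitary[OF U] cancel_cadj_unitary[OF U'] unitary_matD[OF U] flip: matrix_mul_assoc)
  then show ?thesis
    by (simp only: vector_minus_component rdiag_mult_left rdiag_mult_right)
      (simp only: of_real_diff left_diff_distrib mult.commute)
qed

text \<open>The overlaps carry \<open>cadj U ** H ** V\<close> to \<open>cadj U' ** H ** V'\<close>.
  Written with these overlaps, both operators become sums over the same terms and differ only in the
  value of the symbol.\<close>

lemma double_op_diff_entry:
  assumes "unitary_mat U" "unitary_mat V" "unitary_mat U'" "unitary_mat V'"
  shows "(cadj U' ** (double_op F U d V e H - double_op F U' d' V' e' H) ** V') $ m $ n =
    (\<Sum>k\<in>UNIV. \<Sum>l\<in>UNIV. of_real (F (d k) (e l) - F (d' m) (e' n)) * (cadj U' ** U) $ m $ k *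
      (cadj U ** H ** V) $ k $ l * (cadj V ** V') $ l $ n)"
proof -
  define M where "M = cadj U ** H ** V"
  define N where "N = (\<chi> k l. of_real (F (d k) (e l)) * M $ k $ l)"
  have "cadj U' ** double_op F U d V e H ** V' = (cadj U' ** U) ** N ** (cadj V ** V')"
    by (simp add: double_op_def M_def N_def matrix_mul_assoc)
  moreover have "cadj U' ** double_op F U' d' V' e' H ** V' =
      (\<chi> k l. of_real (F (d' k) (e' l)) * (cadj U' ** H ** V') $ k $ l)"
    by (simp add: double_op_def cancel_cadj_unitary[OF assms(3)] cancel_cadj_unitary[OF assms(4)]
        flip: matrix_mul_assoc) (simp add: matrix_mul_assoc unitary_matD assms)
  moreover have "cadj U' ** H ** V' = (cadj U' ** U) ** M ** (cadj V ** V')"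
    unfolding M_def by (metis assms(1,2) cancel_cadj_unitary(4) matrix_mul_assoc)
  ultimately have diff: "cadj U' ** (double_op F U d V e H - double_op F U' d' V' e' H) ** V' =
      (cadj U' ** U) ** N ** (cadj V ** V') -
      (\<chi> k l. of_real (F (d' k) (e' l)) * ((cadj U' ** U) ** M ** (cadj V ** V')) $ k $ l)"
    by (simp add: matrix_diff_ldistrib matrix_diff_rdistrib)
  have triple: "(X ** Y ** Z) $ i $ j = (\<Sum>k\<in>UNIV. \<Sum>l\<in>UNIV. X $ i $ k * Y $ k $ l * Z $ l $ j)"
    for X Y Z :: "complex^'a^'a" and i j
    by (simp add: matrix_matrix_mult_def sum_distrib_right) (rule sum.swap)
  show ?thesis
    unfolding diff M_def[symmetric]
    by (simp only: vector_minus_component vec_lambda_beta triple sum_distrib_left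
        sum_subtractf[symmetric]) (intro sum.cong refl; simp add: N_def algebra_simps)
qed

text \<open>The eigenvectors need not depend continuously on the matrix, but an overlap of eigenvectors
  times the gap of the eigenvalues is an entry of the difference of the matrices.\<close>

lemma double_op_lipschitz:
  fixes U V U' V' :: "complex^'n^'n"
  assumes U: "unitary_mat U" "unitary_mat V" "unitary_mat U'" "unitary_mat V'"
    and A: "A = U ** rdiag d ** cadj U" "A' = U' ** rdiag d' ** cadj U'"
    and B: "B = V ** rdiag e ** cadj V" "B' = V' ** rdiag e' ** cadj V'"
    and L: "L \<ge> 0" "\<And>k l m n. \<bar>F (d k) (e l) - F (d' m) (e' n)\<bar> \<le> L * (\<bar>d k - d' m\<bar> + \<bar>e l - e' n\<bar>)"
  shows "norm (double_op F U d V e H - double_op F U' d' V' e' H)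
    \<le> (real CARD('n))^12 * L * (norm (A - A') + norm (B - B')) * norm H"
proof -
  define K where "K = (real CARD('n))\<^sup>2"
  define D where "D = double_op F U d V e H - double_op F U' d' V' e' H"
  define E where "E = cadj U' ** D ** V'"
  define P where "P = cadj U' ** U"
  define M where "M = cadj U ** H ** V"
  define R where "R = cadj V ** V'"
  note U' = U[THEN unitary_mat_cadj]
  have K0: "K \<ge> 0" by (simp add: K_def)
  have P: "cmod (P $ m $ k) \<le> 1" and R: "cmod (R $ l $ n) \<le> 1" for k l m n
    unfolding P_def R_def by (intro unitary_entry_le_1 unitary_mat_mult U U')+
  have M: "cmod (M $ k $ l) \<le> K * norm H" for k l
    unfolding M_def K_def by (intro unitary_sandwich_entry_le U U')
  have gapP: "\<bar>d k - d' m\<bar> * cmod (P $ m $ k) \<le> K * norm (A - A')" for k m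
  proof -
    have "\<bar>d k - d' m\<bar> * cmod (P $ m $ k) = cmod ((cadj U' ** (A - A') ** U) $ m $ k)"
      unfolding P_def eigen_gap_entry[OF U(1,3) A, symmetric] by (simp only: norm_mult norm_of_real)
    then show ?thesis
      unfolding K_def using unitary_sandwich_entry_le[OF U'(3) U(1)] by metis
  qed
  have gapR: "\<bar>e l - e' n\<bar> * cmod (R $ l $ n) \<le> K * norm (B - B')" for l n
  proof -
    \<comment> \<open>In \<open>R\<close> the primed basis stands on the right, so \<open>B\<close>
      and \<open>B'\<close> exchange their roles in the gap identity.\<close>
    have "\<bar>e l - e' n\<bar> * cmod (R $ l $ n) = cmod ((cadj V ** (B' - B) ** V') $ l $ n)"
      unfolding R_def eigen_gap_entry[OF U(4,2) B(2,1), symmetric]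
      by (simp only: norm_mult norm_of_real abs_minus_commute)
    then show ?thesis
      unfolding K_def using unitary_sandwich_entry_le[OF U'(2) U(4)] by (metis norm_minus_commute)
  qed
  have E: "cmod (E $ m $ n) \<le> K * (L * (K * (norm (A - A') + norm (B - B'))) * (K * norm H))" for m n
  proof -
    have summand: "cmod (of_real (F (d k) (e l) - F (d' m) (e' n)) * P $ m $ k * M $ k $ l * R $ l $ n)
        \<le> L * (K * (norm (A - A') + norm (B - B'))) * (K * norm H)" for k l
    proof -
      have "\<bar>F (d k) (e l) - F (d' m) (e' n)\<bar> * cmod (P $ m $ k) * cmod (R $ l $ n)
          \<le> L * (\<bar>d k - d' m\<bar> + \<bar>e l - e' n\<bar>) * cmod (P $ m $ k) * cmod (R $ l $ n)"
        by (intro mult_right_mono L) auto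
      \<comment> \<open>Each gap is paired with its own overlap, which makes it small; the other
        overlap is at most 1.\<close>
      also have "\<dots> = L * ((\<bar>d k - d' m\<bar> * cmod (P $ m $ k)) * cmod (R $ l $ n) +
          (\<bar>e l - e' n\<bar> * cmod (R $ l $ n)) * cmod (P $ m $ k))"
        by (simp add: algebra_simps)
      also have "\<dots> \<le> L * ((K * norm (A - A')) * 1 + (K * norm (B - B')) * 1)"
        by (intro mult_left_mono add_mono mult_mono gapP gapR P R L) (auto simp: K0)
      finally have 1: "\<bar>F (d k) (e l) - F (d' m) (e' n)\<bar> * cmod (P $ m $ k) * cmod (R $ l $ n)
          \<le> L * (K * (norm (A - A') + norm (B - B')))"
        by (simp add: algebra_simps)
      have "cmod (of_real (F (d k) (e l) - F (d' m) (e' n)) * P $ m $ k * M $ k $ l * R $ l $ n) =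
          (\<bar>F (d k) (e l) - F (d' m) (e' n)\<bar> * cmod (P $ m $ k) * cmod (R $ l $ n)) * cmod (M $ k $ l)"
        by (simp only: norm_mult norm_of_real mult_ac)
      also have "\<dots> \<le> L * (K * (norm (A - A') + norm (B - B'))) * (K * norm H)"
        by (intro mult_mono 1 M) (auto simp: K0 L)
      finally show ?thesis .
    qed
    have "cmod (E $ m $ n) \<le> (\<Sum>k\<in>(UNIV::'n set). \<Sum>l\<in>(UNIV::'n set).
        L * (K * (norm (A - A') + norm (B - B'))) * (K * norm H))"
      unfolding E_def D_def double_op_diff_entry[OF U] P_def[symmetric] M_def[symmetric] R_def[symmetric]
      by (intro sum_norm_le summand)
    also have "\<dots> = K * (L * (K * (norm (A - A') + norm (B - B'))) * (K * norm H))"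
      by (simp add: K_def power2_eq_square)
    finally show ?thesis .
  qed
  have "D = U' ** E ** cadj V'"
    unfolding E_def by (metis U(3,4) cancel_cadj_unitary(2,4) matrix_mul_assoc)
  then have "norm D \<le> K * K * norm E"
    using unitary_sandwich_norm_le[OF U(3) U'(4), of E] by (simp add: K_def power4_eq_xxxx power2_eq_square mult.assoc)
  also have "\<dots> \<le> K * K * (K * (K * (L * (K * (norm (A - A') + norm (B - B'))) * (K * norm H))))"
    using matrix_norm_le[of E, OF E] by (intro mult_left_mono) (auto simp: K_def power2_eq_square)
  \<comment> \<open>Two factors \<open>K\<close> come from undoing the conjugation, one from passing
    from entries to the norm and three from \<open>E\<close>; \<open>K\<close> is the square of the
    dimension.\<close>
  also have "\<dots> = (real CARD('n))^12 * L * (norm (A - A') + norm (B - B')) * norm H"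
    by (simp add: K_def mult_ac flip: power_add power_mult)
  finally show ?thesis unfolding D_def .
qed

text \<open>A crude form of Weyl's perturbation inequality: some eigenvector of \<open>A\<close> has
  a substantial overlap with the given eigenvector of \<open>B\<close>, and the gap identity then
  bounds the distance of the two eigenvalues.\<close>

lemma spectrum_near:
  fixes U V :: "complex^'n^'n"
  assumes U: "unitary_mat U" and V: "unitary_mat V"
    and A: "A = U ** rdiag d ** cadj U" and B: "B = V ** rdiag e ** cadj V"
  obtains m where "\<bar>e l - d m\<bar> \<le> (real CARD('n))^3 * norm (B - A)"
proof -
  define W where "W = cadj U ** V"
  have W: "unitary_mat W"
    unfolding W_def by (intro unitary_mat_mult unitary_mat_cadj U V)
  \<comment> \<open>A column of \<open>W\<close> has unit length, so some squared modulus is at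
    least 1 / n; as moduli are at most 1, the modulus itself is too.\<close>
  obtain m where m: "1 / real CARD('n) \<le> cmod (W $ m $ l)"
  proof (rule ccontr)
    assume "\<not> thesis"
    then have small: "cmod (W $ m $ l) < 1 / real CARD('n)" for m
      using that by (meson not_le)
    have "(cmod (W $ m $ l))\<^sup>2 < 1 / real CARD('n)" for m
    proof -
      have "(cmod (W $ m $ l))\<^sup>2 \<le> cmod (W $ m $ l)"
        using unitary_entry_le_1[OF W] by (simp add: power2_eq_square mult_left_le)
      with small[of m] show ?thesis by linarith
    qed
    then have "(\<Sum>m\<in>UNIV. (cmod (W $ m $ l))\<^sup>2) < (\<Sum>m\<in>(UNIV::'n set). 1 / real CARD('n))"
      by (intro sum_strict_mono) auto
    then show False unfolding unitary_col_norm[OF W] by simp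
  qed
  have "\<bar>e l - d m\<bar> * cmod (W $ m $ l) = cmod ((cadj U ** (B - A) ** V) $ m $ l)"
    unfolding W_def eigen_gap_entry[OF V U B A, symmetric] by (simp only: norm_mult norm_of_real)
  also have "\<dots> \<le> (real CARD('n))\<^sup>2 * norm (B - A)"
    by (intro unitary_sandwich_entry_le unitary_mat_cadj U V)
  finally have "\<bar>e l - d m\<bar> * (1 / real CARD('n)) \<le> (real CARD('n))\<^sup>2 * norm (B - A)"
    using mult_left_mono[OF m, of "\<bar>e l - d m\<bar>"] by linarith
  then have "\<bar>e l - d m\<bar> \<le> (real CARD('n))^3 * norm (B - A)"
    by (simp add: field_simps power3_eq_cube power2_eq_square)
  then show ?thesis by (rule that)
qed

text \<open>Close to \<open>A0\<close> all spectra lie in one interval \<open>{a..b}\<close> with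
  \<open>a > 0\<close>, so a single Lipschitz constant of \<open>F\<close> serves every choice of
  eigenbases.\<close>

lemma double_op_near:
  fixes A0 U0 :: "complex^'n^'n"
  assumes F: "locally_lipschitz_pos F"
    and U0: "unitary_mat U0" and A0: "A0 = U0 ** rdiag d0 ** cadj U0" and d0: "\<And>i. d0 i > 0"
  obtains \<delta> C where "\<delta> > 0" "C \<ge> 0"
    "\<And>U d V e H. \<lbrakk>unitary_mat U; unitary_mat V; norm (U ** rdiag d ** cadj U - A0) < \<delta>;
      norm (V ** rdiag e ** cadj V - A0) < \<delta>\<rbrakk> \<Longrightarrow>
      norm (double_op F U d V e H - double_op F U0 d0 U0 d0 H) \<le>
      C * (norm (U ** rdiag d ** cadj U - A0) + norm (V ** rdiag e ** cadj V - A0)) * norm H"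
proof -
  \<comment> \<open>Half the least eigenvalue leaves a margin \<open>a\<close> on either side of the
    spectrum of \<open>A0\<close>.\<close>
  define a b where "a = Min (range d0) / 2" and "b = Max (range d0) + a"
  have lo: "2 * a \<le> d0 i" and hi: "d0 i + a \<le> b" for i
    by (auto simp: a_def b_def)
  have "Min (range d0) > 0"
    using d0 by simp
  then have a: "a > 0" by (simp add: a_def)
  then obtain L where L: "L \<ge> 0"
    "\<And>x x' y y'. \<lbrakk>x \<in> {a..b}; x' \<in> {a..b}; y \<in> {a..b}; y' \<in> {a..b}\<rbrakk> \<Longrightarrow>
      \<bar>F x y - F x' y'\<bar> \<le> L * (\<bar>x - x'\<bar> + \<bar>y - y'\<bar>)"
    using F[unfolded locally_lipschitz_pos_def, rule_format, of a b] by metis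
  \<comment> \<open>Within this radius \<open>spectrum_near\<close> moves eigenvalues by less than
    the margin \<open>a\<close>.\<close>
  define \<delta> where "\<delta> = a / (real CARD('n))^3"
  have \<delta>: "\<delta> > 0" using a by (simp add: \<delta>_def)
  have spec: "d i \<in> {a..b}" if U: "unitary_mat U" and near: "norm (U ** rdiag d ** cadj U - A0) < \<delta>" for U d i
  proof -
    obtain m where m: "\<bar>d i - d0 m\<bar> \<le> (real CARD('n))^3 * norm (U ** rdiag d ** cadj U - A0)"
      using spectrum_near[OF U0 U A0 refl] by metis
    have "(real CARD('n))^3 * norm (U ** rdiag d ** cadj U - A0) < a"
      using near by (simp add: \<delta>_def field_simps)
    with m lo[of m] hi[of m] show ?thesis by auto
  qed
  have spec0: "d0 i \<in> {a..b}" for i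
    using lo[of i] hi[of i] a by auto
  show ?thesis
  proof (rule that[OF \<delta>])
    show "(real CARD('n))^12 * L \<ge> 0" using L by simp
    fix U d V e and H :: "complex^'n^'n"
    assume *: "unitary_mat U" "unitary_mat V" "norm (U ** rdiag d ** cadj U - A0) < \<delta>"
      "norm (V ** rdiag e ** cadj V - A0) < \<delta>"
    show "norm (double_op F U d V e H - double_op F U0 d0 U0 d0 H) \<le> (real CARD('n))^12 * L *
      (norm (U ** rdiag d ** cadj U - A0) + norm (V ** rdiag e ** cadj V - A0)) * norm H"
      by (rule double_op_lipschitz[OF *(1,2) U0 U0 refl A0 refl A0 L(1) L(2)])
        (rule spec[OF *(1,3)] spec0 spec[OF *(2,4)])+
  qed
qed

section \<open>Derivatives of matrix functions\<close>

text \<open>The Frechet derivative of the functional calculus (Daleckii--Krein): in an eigenbasis of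
  \<open>A\<close>, the Schur product with the divided differences \<open>F\<close>.\<close>

definition mat_deriv :: "(real \<Rightarrow> real \<Rightarrow> real) \<Rightarrow> complex^'n^'n \<Rightarrow> complex^'n^'n \<Rightarrow> complex^'n^'n" where
  "mat_deriv F A H = (THE G. \<exists>U d. unitary_mat U \<and> A = U ** rdiag d ** cadj U \<and>
      G = double_op F U d U d H)"

text \<open>Eigenvectors for different eigenvalues are orthogonal, so only terms with matching
  eigenvalues survive, and there the symbols agree. This makes the description in
  \<open>mat_deriv\<close> definite.\<close>

lemma double_op_unique:
  assumes U: "unitary_mat U" and V: "unitary_mat V"
    and eq: "U ** rdiag d ** cadj U = V ** rdiag e ** cadj V"
  shows "double_op F U d U d H = double_op F V e V e H"
proof -
  have P: "(cadj V ** U) $ m $ k = 0" if "d k \<noteq> e m" for k m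
    using eigen_gap_entry[OF U V refl eq, where d = d and k = k and m = m] that
    by (simp add: matrix_matrix_mult_def vec_eq_iff)
  have R: "(cadj U ** V) $ k $ m = 0" if "d k \<noteq> e m" for k m
    using eigen_gap_entry[OF V U refl eq[symmetric], where d = e and k = m and m = k] that
    by (simp add: matrix_matrix_mult_def vec_eq_iff)
  have summand: "complex_of_real (F (d k) (d l) - F (e m) (e n)) * (cadj V ** U) $ m $ k * M $ k $ l *
      (cadj U ** V) $ l $ n = 0" for k l m n and M :: "complex^'a^'a"
    using P[of k m] R[of l n] by (cases "d k = e m"; cases "d l = e n") simp_all
  define D where "D = double_op F U d U d H - double_op F V e V e H"
  have "cadj V ** D ** V = 0"
    unfolding vec_eq_iff D_def double_op_diff_entry[OF U U V V] by (simp only: summand sum.neutral_const) simp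
  then have "V ** (cadj V ** D ** V) ** cadj V = 0"
    by (simp add: matrix_matrix_mult_def vec_eq_iff)
  moreover have "V ** (cadj V ** D ** V) ** cadj V = D"
    by (metis V cancel_cadj_unitary(2,4) matrix_mul_assoc)
  ultimately show ?thesis by (simp add: D_def)
qed

lemma mat_deriv_unitary_diag:
  assumes "unitary_mat U"
  shows "mat_deriv F (U ** rdiag d ** cadj U) H = double_op F U d U d H"
  unfolding mat_deriv_def by (rule the_equality) (use assms double_op_unique in metis)+

lemma linear_double_op: "linear (double_op F U d V e)"
proof (rule linearI)
  fix H H' :: "complex^'a^'a" and r :: real
  define S where "S X = (\<chi> k l. of_real (F (d k) (e l)) * X $ k $ l)" for X :: "complex^'a^'a"
  have S: "S (X + Y) = S X + S Y" "S (r *\<^sub>R X) = r *\<^sub>R S X" for X Y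
    by (simp_all add: S_def vec_eq_iff distrib_left)
  have S_op: "double_op F U d V e H = U ** S (cadj U ** H ** V) ** cadj V" for H
    by (simp add: double_op_def S_def)
  show "double_op F U d V e (H + H') = double_op F U d V e H + double_op F U d V e H'"
    unfolding S_op matrix_add_ldistrib matrix_add_rdistrib S ..
  show "double_op F U d V e (r *\<^sub>R H) = r *\<^sub>R double_op F U d V e H"
    unfolding S_op matrix_scaleR_ldistrib matrix_scaleR_rdistrib S ..
qed

lemma bounded_linear_mat_deriv:
  assumes "positive_definite A"
  shows "bounded_linear (mat_deriv F A)"
proof -
  obtain U d where "unitary_mat U" "A = U ** rdiag d ** cadj U"
    using positive_definite_diagonalization[OF assms] by metis
  then have "mat_deriv F A = double_op F U d U d"
    using mat_deriv_unitary_diag by blast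
  then show ?thesis
    using linear_double_op linear_conv_bounded_linear by metis
qed

text \<open>An exact increment formula, with the eigenbasis of \<open>A\<close> on the left and that
  of \<open>B\<close> on the right. Differentiability thus reduces to continuity of
  \<open>double_op\<close> in its second diagonalization.\<close>

lemma mat_fun_diff:
  assumes U: "unitary_mat U" and V: "unitary_mat V"
    and A: "A = U ** rdiag d ** cadj U" and B: "B = V ** rdiag e ** cadj V"
  shows "mat_fun f B - mat_fun f A = double_op (divided_difference f f') U d V e (B - A)"
proof -
  define W where "W = cadj U ** V"
  have diff: "(cadj U ** (V ** rdiag g ** cadj V - U ** rdiag h ** cadj U) ** V) $ k $ l =
      of_real (g l - h k) * W $ k $ l" for g h k l
    unfolding W_def using eigen_gap_entry[OF V U refl refl, of g l h k] by simp
  \<comment> \<open>If the eigenvalues coincide, both sides are 0.\<close>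
  have F: "complex_of_real (f (e l) - f (d k)) * w =
      of_real (divided_difference f f' (d k) (e l)) * (of_real (e l - d k) * w)" for k l w
    by (auto simp: divided_difference_def field_simps)
  define D where "D = mat_fun f B - mat_fun f A"
  have "cadj U ** D ** V =
      (\<chi> k l. of_real (divided_difference f f' (d k) (e l)) * (cadj U ** (B - A) ** V) $ k $ l)"
    unfolding D_def A B mat_fun_unitary_diag[OF U] mat_fun_unitary_diag[OF V]
    by (simp only: vec_eq_iff vec_lambda_beta diff F) simp
  moreover have "D = U ** (cadj U ** D ** V) ** cadj V"
    by (metis U V cancel_cadj_unitary(2,4) matrix_mul_assoc)
  ultimately show ?thesis unfolding double_op_def D_def by metis
qed

text \<open>By the increment formula the remainder is a difference of two double operator integrals
  applied to \<open>B - A\<close>, hence quadratic in \<open>norm (B - A)\<close>. The derivative is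
  taken within the positive definite matrices because a neighbourhood also contains non-Hermitian
  ones, where \<open>mat_fun\<close> is unspecified.\<close>

theorem has_derivative_mat_fun:
  fixes A :: "complex^'n^'n"
  assumes A: "positive_definite A" and F: "locally_lipschitz_pos (divided_difference f f')"
  shows "(mat_fun f has_derivative mat_deriv (divided_difference f f') A)
      (at A within {A. positive_definite A})"
  unfolding has_derivative_within_alt
proof (intro conjI allI impI)
  show "bounded_linear (mat_deriv (divided_difference f f') A)"
    by (rule bounded_linear_mat_deriv[OF A])
  let ?F = "divided_difference f f'"
  obtain U d where U: "unitary_mat U" and Ad: "A = U ** rdiag d ** cadj U" and d: "\<And>i. d i > 0"
    using positive_definite_diagonalization[OF A] by metis
  obtain \<delta> C where \<delta>: "\<delta> > 0" and C: "C \<ge> 0" and near: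
    "\<And>V e V' e' H. \<lbrakk>unitary_mat V; unitary_mat V'; norm (V ** rdiag e ** cadj V - A) < \<delta>;
      norm (V' ** rdiag e' ** cadj V' - A) < \<delta>\<rbrakk> \<Longrightarrow>
      norm (double_op ?F V e V' e' H - double_op ?F U d U d H) \<le>
      C * (norm (V ** rdiag e ** cadj V - A) + norm (V' ** rdiag e' ** cadj V' - A)) * norm H"
    using double_op_near[OF F U Ad d] by metis
  fix \<epsilon> :: real assume \<epsilon>: "\<epsilon> > 0"
  show "\<exists>\<delta>'>0. \<forall>B\<in>{A. positive_definite A}. norm (B - A) < \<delta>' \<longrightarrow>
      norm (mat_fun f B - mat_fun f A - mat_deriv ?F A (B - A)) \<le> \<epsilon> * norm (B - A)"
  \<comment> \<open>\<open>C\<close> may be 0, hence the denominator \<open>C + 1\<close>.\<close>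
  proof (intro exI[of _ "min \<delta> (\<epsilon> / (C + 1))"] conjI ballI impI)
    show "min \<delta> (\<epsilon> / (C + 1)) > 0" using \<delta> C \<epsilon> by simp
    fix B :: "complex^'n^'n"
    assume "B \<in> {A. positive_definite A}" and B: "norm (B - A) < min \<delta> (\<epsilon> / (C + 1))"
    then obtain V e where V: "unitary_mat V" and Be: "B = V ** rdiag e ** cadj V"
      using positive_definite_diagonalization[of B] by (metis mem_Collect_eq)
    have "norm (double_op ?F U d V e (B - A) - double_op ?F U d U d (B - A))
        \<le> C * (norm (A - A) + norm (B - A)) * norm (B - A)"
      unfolding Be using near[OF U V, of d e] B \<delta> Ad Be by simp
    then have "norm (mat_fun f B - mat_fun f A - mat_deriv ?F A (B - A)) \<le> C * norm (B - A) * norm (B - A)"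
      unfolding mat_fun_diff[OF U V Ad Be, of f f'] by (subst Ad, subst mat_deriv_unitary_diag[OF U]) simp
    also have "\<dots> \<le> \<epsilon> * norm (B - A)"
    proof (rule mult_right_mono)
      have "C * norm (B - A) \<le> (C + 1) * norm (B - A)" by (simp add: mult_right_mono)
      also have "\<dots> \<le> \<epsilon>" using B C by (simp add: field_simps)
      finally show "C * norm (B - A) \<le> \<epsilon>" .
    qed simp
    finally show "norm (mat_fun f B - mat_fun f A - mat_deriv ?F A (B - A)) \<le> \<epsilon> * norm (B - A)" .
  qed
qed

lemma has_vector_derivative_mat_fun:
  assumes "(\<sigma> has_vector_derivative J) (at t)" and pd: "\<And>s. positive_definite (\<sigma> s)"
    and F: "locally_lipschitz_pos (divided_difference f f')"
  shows "((\<lambda>s. mat_fun f (\<sigma> s)) has_vector_derivative mat_deriv (divided_difference f f') (\<sigma> t) J) (at t)"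
proof -
  have "((mat_fun f \<circ> \<sigma>) has_derivative
      mat_deriv (divided_difference f f') (\<sigma> t) \<circ> (\<lambda>h. h *\<^sub>R J)) (at t)"
    using assms(1) unfolding has_vector_derivative_def
    by (rule diff_chain_within[where s = UNIV])
      (rule has_derivative_subset[OF has_derivative_mat_fun[OF pd F]], use pd in auto)
  moreover have "mat_deriv (divided_difference f f') (\<sigma> t) (h *\<^sub>R J) =
      h *\<^sub>R mat_deriv (divided_difference f f') (\<sigma> t) J" for h
    by (rule linear_cmul) (use bounded_linear_mat_deriv[OF pd] bounded_linear.linear in blast)
  ultimately show ?thesis
    by (simp add: has_vector_derivative_def o_def)
qed

text \<open>Moving the base point costs a Lipschitz bound times \<open>norm (H s)\<close>, which
  stays bounded; at the fixed base point the map is linear and continuous. This joint continuity is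
  what the factor \<open>G\<close> of the mixed derivatives requires.\<close>

lemma tendsto_mat_deriv:
  fixes A0 :: "complex^'n^'n"
  assumes A0: "positive_definite A0" and F: "locally_lipschitz_pos F"
    and pd: "\<And>s. positive_definite (A s)"
    and A: "(A \<longlongrightarrow> A0) G" and H: "(H \<longlongrightarrow> H0) G"
  shows "((\<lambda>s. mat_deriv F (A s) (H s)) \<longlongrightarrow> mat_deriv F A0 H0) G"
proof -
  obtain U d where U: "unitary_mat U" and Ad: "A0 = U ** rdiag d ** cadj U" and d: "\<And>i. d i > 0"
    using positive_definite_diagonalization[OF A0] by metis
  obtain \<delta> C where \<delta>: "\<delta> > 0" and C: "C \<ge> 0" and near:
    "\<And>V e V' e' H. \<lbrakk>unitary_mat V; unitary_mat V'; norm (V ** rdiag e ** cadj V - A0) < \<delta>;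
      norm (V' ** rdiag e' ** cadj V' - A0) < \<delta>\<rbrakk> \<Longrightarrow>
      norm (double_op F V e V' e' H - double_op F U d U d H) \<le>
      C * (norm (V ** rdiag e ** cadj V - A0) + norm (V' ** rdiag e' ** cadj V' - A0)) * norm H"
    using double_op_near[OF F U Ad d] by metis
  have "\<forall>\<^sub>F s in G. dist (A s) A0 < \<delta>"
    using A \<delta> by (rule tendstoD)
  then have "\<forall>\<^sub>F s in G. norm (mat_deriv F (A s) (H s) - mat_deriv F A0 (H s))
      \<le> C * (norm (A s - A0) + norm (A s - A0)) * norm (H s)"
  proof eventually_elim
    fix s assume s: "dist (A s) A0 < \<delta>"
    obtain V e where V: "unitary_mat V" and As: "A s = V ** rdiag e ** cadj V"
      using positive_definite_diagonalization[OF pd] by metis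
    have "mat_deriv F A0 (H s) = double_op F U d U d (H s)"
      unfolding Ad by (rule mat_deriv_unitary_diag[OF U])
    moreover have "mat_deriv F (A s) (H s) = double_op F V e V e (H s)"
      unfolding As by (rule mat_deriv_unitary_diag[OF V])
    ultimately show "norm (mat_deriv F (A s) (H s) - mat_deriv F A0 (H s))
        \<le> C * (norm (A s - A0) + norm (A s - A0)) * norm (H s)"
      using near[OF V V, of e e "H s"] s As by (simp add: dist_norm)
  qed
  moreover have "((\<lambda>s. C * (norm (A s - A0) + norm (A s - A0)) * norm (H s)) \<longlongrightarrow>
      C * (norm (A0 - A0) + norm (A0 - A0)) * norm H0) G"
    by (intro tendsto_mult tendsto_add tendsto_norm tendsto_diff tendsto_const A H)
  ultimately have diff: "((\<lambda>s. mat_deriv F (A s) (H s) - mat_deriv F A0 (H s)) \<longlongrightarrow> 0) G"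
    using Lim_null_comparison by fastforce
  have "((\<lambda>s. mat_deriv F A0 (H s)) \<longlongrightarrow> mat_deriv F A0 H0) G"
    by (rule bounded_linear.tendsto[OF bounded_linear_mat_deriv[OF A0] H])
  then show ?thesis
    using diff by (rule Lim_transform)
qed

section \<open>Trace identities for first derivatives\<close>

lemma trace_unitary_conj:
  assumes "unitary_mat U"
  shows "trace (U ** M ** cadj U) = trace M"
proof -
  have "trace (U ** M ** cadj U) = trace (cadj U ** (U ** M))"
    by (rule trace_mul_sym)
  then show ?thesis by (simp add: cancel_cadj_unitary[OF assms])
qed

text \<open>In an eigenbasis \<open>mat_fun g A\<close> is diagonal, so the trace sees only the
  diagonal of the Schur product, where the divided difference equals \<open>f'\<close>.\<close>

lemma trace_mat_fun_mat_deriv: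
  assumes "positive_definite A"
  shows "trace (mat_fun g A ** mat_deriv (divided_difference f f') A J) =
    trace (mat_fun (\<lambda>x. g x * f' x) A ** J)"
proof -
  obtain U d where U: "unitary_mat U" and Ad: "A = U ** rdiag d ** cadj U"
    using positive_definite_diagonalization[OF assms] by metis
  define M where "M = cadj U ** J ** U"
  have J: "J = U ** M ** cadj U"
    unfolding M_def by (metis U cancel_cadj_unitary(2,4) matrix_mul_assoc)
  have conj: "(U ** X ** cadj U) ** (U ** Y ** cadj U) = U ** (X ** Y) ** cadj U" for X Y
    by (simp add: cancel_cadj_unitary[OF U] flip: matrix_mul_assoc)
  have "trace (rdiag (\<lambda>i. g (d i)) **
        (\<chi> k l. of_real (divided_difference f f' (d k) (d l)) * M $ k $ l)) =
      trace (rdiag (\<lambda>i. g (d i) * f' (d i)) ** M)"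
    by (simp add: trace_def rdiag_mult_left divided_difference_def mult.assoc)
  then show ?thesis
    unfolding Ad mat_fun_unitary_diag[OF U] mat_deriv_unitary_diag[OF U] double_op_def M_def[symmetric]
    by (subst J) (simp only: conj trace_unitary_conj[OF U])
qed

section \<open>Mixed derivatives of the divergences\<close>

abbreviation diff_powr :: "real \<Rightarrow> real \<Rightarrow> real \<Rightarrow> real" where
  "diff_powr s \<equiv> divided_difference (\<lambda>t. t powr s) (\<lambda>t. s * t powr (s - 1))"

abbreviation diff_ln :: "real \<Rightarrow> real \<Rightarrow> real" where
  "diff_ln \<equiv> divided_difference ln (\<lambda>t. 1 / t)"

lemma locally_lipschitz_pos_diff_powr: "locally_lipschitz_pos (diff_powr s)"
proof (rule locally_lipschitz_pos_divided_difference)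
  fix x :: real assume "x > 0"
  then show "((\<lambda>t. t powr s) has_real_derivative s * x powr (s - 1)) (at x)"
    by (rule has_real_derivative_powr)
  show "((\<lambda>t. s * t powr (s - 1)) has_real_derivative s * ((s - 1) * x powr (s - 1 - 1))) (at x)"
    by (rule DERIV_cmult[OF has_real_derivative_powr[OF \<open>x > 0\<close>]])
qed (auto intro!: continuous_intros)

lemma locally_lipschitz_pos_diff_ln: "locally_lipschitz_pos diff_ln"
proof (rule locally_lipschitz_pos_divided_difference)
  fix x :: real assume "x > 0"
  then show "(ln has_real_derivative 1 / x) (at x)"
    by (rule DERIV_ln_divide)
  show "((\<lambda>t. 1 / t) has_real_derivative - (1 / x\<^sup>2)) (at x)"
    using \<open>x > 0\<close> by (auto intro!: derivative_eq_intros simp: power2_eq_square)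
qed (auto intro!: continuous_intros)

section \<open>Functional calculus of positive definite matrices\<close>

lemma mat_fun_cong_pos:
  assumes "positive_definite A" "\<And>x. x > 0 \<Longrightarrow> f x = g x"
  shows "mat_fun f A = mat_fun g A"
proof -
  obtain U d where "unitary_mat U" "A = U ** rdiag d ** cadj U" "\<And>i. d i > 0"
    using positive_definite_diagonalization[OF assms(1)] by metis
  then show ?thesis using assms(2) by (simp add: mat_fun_unitary_diag)
qed

lemma rdiag_const: "rdiag (\<lambda>_. c) = c *\<^sub>R mat 1"
  by (auto simp: rdiag_def mat_def vec_eq_iff complex_eq_iff)

lemma mat_fun_const:
  assumes "positive_definite A"
  shows "mat_fun (\<lambda>_. c) A = c *\<^sub>R mat 1"
proof -
  obtain U d where U: "unitary_mat U" "A = U ** rdiag d ** cadj U"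
    using positive_definite_diagonalization[OF assms(1)] by metis
  have "mat_fun (\<lambda>_. c) A = U ** (c *\<^sub>R mat 1) ** cadj U"
    using U by (simp add: mat_fun_unitary_diag rdiag_const)
  then show ?thesis
    by (simp add: matrix_scaleR_ldistrib matrix_scaleR_rdistrib unitary_matD(2)[OF U(1)])
qed

lemma rdiag_mult: "rdiag f ** rdiag g = rdiag (\<lambda>i. f i * g i)"
  by (simp add: vec_eq_iff rdiag_mult_left) (simp add: rdiag_def)

lemma mat_powr_mult:
  assumes "positive_definite A"
  shows "mat_powr A s ** mat_powr A t = mat_powr A (s + t)"
proof -
  obtain U d where U: "unitary_mat U" "A = U ** rdiag d ** cadj U"
    using positive_definite_diagonalization[OF assms(1)] by metis
  have "mat_powr A s ** mat_powr A t = U ** (rdiag (\<lambda>i. d i powr s) ** rdiag (\<lambda>i. d i powr t)) ** cadj U"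
    unfolding U(2) mat_powr_def mat_fun_unitary_diag[OF U(1)]
    by (simp add: cancel_cadj_unitary[OF U(1)] flip: matrix_mul_assoc)
  then show ?thesis
    using U by (simp add: mat_powr_def mat_fun_unitary_diag rdiag_mult powr_add)
qed

lemma mat_powr_mat_powr:
  assumes "positive_definite A"
  shows "mat_powr (mat_powr A s) t = mat_powr A (s * t)"
proof -
  obtain U d where U: "unitary_mat U" "A = U ** rdiag d ** cadj U"
    using positive_definite_diagonalization[OF assms(1)] by metis
  then show ?thesis
    by (simp add: mat_powr_def mat_fun_unitary_diag powr_powr)
qed

lemma mat_powr_one:
  assumes "positive_definite A"
  shows "mat_powr A 1 = A"
proof -
  obtain U d where "unitary_mat U" "A = U ** rdiag d ** cadj U" "\<And>i. d i > 0"
    using positive_definite_diagonalization[OF assms(1)] by metis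
  then show ?thesis
    by (simp add: mat_powr_def mat_fun_unitary_diag less_imp_le)
qed

lemma positive_definite_mat_powr: "positive_definite A \<Longrightarrow> positive_definite (mat_powr A s)"
  unfolding mat_powr_def by (rule positive_definite_mat_fun) auto

lemma trace_positive_definite_pos:
  assumes "positive_definite A"
  shows "Re (trace A) > 0"
proof -
  obtain U d where U: "unitary_mat U" "A = U ** rdiag d ** cadj U" "\<And>i. d i > 0"
    using positive_definite_diagonalization[OF assms(1)] by metis
  then have "Re (trace A) = (\<Sum>i\<in>UNIV. d i)"
    by (simp add: trace_unitary_conj) (simp add: trace_def rdiag_def)
  then show ?thesis
    using U(3) by (simp add: sum_pos)
qed

lemma trace_mat_deriv:
  assumes "positive_definite A"
  shows "trace (mat_deriv (divided_difference f f') A J) = trace (mat_fun f' A ** J)"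
  using trace_mat_fun_mat_deriv[OF assms, of "\<lambda>_. 1" f f' J] by (simp add: mat_fun_const[OF assms])

text \<open>The exponent \<open>1 - q\<close> is the one for which the weight times the derivative
  of the power is the constant \<open>q\<close>; along states the right-hand side has real part
  0.\<close>

lemma trace_mat_powr_mat_deriv_powr:
  assumes "positive_definite A"
  shows "trace (mat_powr A (1 - q) ** mat_deriv (diff_powr q) A J) = q *\<^sub>R trace J"
proof -
  have "mat_fun (\<lambda>x. x powr (1 - q) * (q * x powr (q - 1))) A = mat_fun (\<lambda>_. q) A"
    by (rule mat_fun_cong_pos[OF assms]) (simp add: powr_add[symmetric] mult.left_commute)
  then show ?thesis
    by (simp add: mat_powr_def trace_mat_fun_mat_deriv[OF assms] mat_fun_const[OF assms]
        matrix_scaleR_rdistrib trace_scaleR)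
qed

lemma trace_mult_mat_deriv_ln:
  assumes "positive_definite A"
  shows "trace (A ** mat_deriv diff_ln A J) = trace J"
proof -
  \<comment> \<open>\<open>A\<close> is written as its first power to become a function of
    itself.\<close>
  have "mat_fun (\<lambda>x. x powr 1 * (1 / x)) A = mat_fun (\<lambda>_. 1) A"
    by (rule mat_fun_cong_pos[OF assms]) simp
  then show ?thesis
    using trace_mat_fun_mat_deriv[OF assms, of "\<lambda>x. x powr 1" ln "\<lambda>t. 1 / t" J]
    by (simp only: mat_powr_one[OF assms, unfolded mat_powr_def] mat_fun_const[OF assms]) simp
qed

text \<open>The product rule at a zero of \<open>P\<close>: the quotient \<open>P h / h\<close>
  tends to \<open>P'\<close>, so \<open>G\<close> only has to be continuous at 0. This is why no
  second derivative of a matrix function occurs.\<close>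

lemma has_real_derivative_trace_mult:
  fixes P G :: "real \<Rightarrow> complex^'n^'n"
  assumes P: "(P has_vector_derivative P') (at 0)" and P0: "P 0 = 0" and G: "(G \<longlongrightarrow> G 0) (at 0)"
  shows "((\<lambda>s. Re (trace (P s ** G s))) has_real_derivative Re (trace (P' ** G 0))) (at 0)"
proof -
  have "((\<lambda>h. norm (P h - h *\<^sub>R P') / norm h) \<longlongrightarrow> 0) (at 0)"
    using P P0 by (simp add: has_vector_derivative_def has_derivative_at)
  moreover have "norm ((1 / h) *\<^sub>R P h - P') = norm (P h - h *\<^sub>R P') / norm h" if "h \<noteq> 0" for h
  proof -
    have "(1 / h) *\<^sub>R P h - P' = (1 / h) *\<^sub>R (P h - h *\<^sub>R P')"
      using that by (simp add: scaleR_diff_right)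
    then show ?thesis by (simp add: real_norm_def)
  qed
  then have "\<forall>\<^sub>F h in at 0. norm (P h - h *\<^sub>R P') / norm h = norm ((1 / h) *\<^sub>R P h - P')"
    by (auto simp: eventually_at_filter)
  ultimately have "((\<lambda>h. norm ((1 / h) *\<^sub>R P h - P')) \<longlongrightarrow> 0) (at 0)"
    using tendsto_cong by fast
  then have "((\<lambda>h. (1 / h) *\<^sub>R P h) \<longlongrightarrow> P') (at 0)"
    by (simp add: LIM_zero_iff tendsto_norm_zero_iff)
  then have "((\<lambda>h. Re (trace ((1 / h) *\<^sub>R P h ** G h))) \<longlongrightarrow> Re (trace (P' ** G 0))) (at 0)"
    by (intro bounded_linear.tendsto[OF bounded_linear_Re_trace]
        bounded_bilinear.tendsto[OF bounded_bilinear_matrix_mult] G)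
  moreover have "Re (trace ((1 / h) *\<^sub>R P h ** G h)) = Re (trace (P h ** G h)) / h" for h
    by (simp add: matrix_scaleR_rdistrib trace_scaleR)
  moreover have "Re (trace (P 0 ** G 0)) = 0"
    by (simp add: P0 trace_def)
  ultimately show ?thesis
    by (simp add: has_field_derivative_iff)
qed

lemmas has_vector_derivative_matrix_mult = bounded_bilinear.has_vector_derivative[OF bounded_bilinear_matrix_mult]

lemma has_vector_derivative_mat_powr:
  assumes "(\<sigma> has_vector_derivative J) (at t)" and pd: "\<And>s. positive_definite (\<sigma> s)"
  shows "((\<lambda>s. mat_powr (\<sigma> s) q) has_vector_derivative mat_deriv (diff_powr q) (\<sigma> t) J) (at t)"
  unfolding mat_powr_def
  by (rule has_vector_derivative_mat_fun[OF assms locally_lipschitz_pos_diff_powr])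

lemma bounded_linear_has_real_derivative:
  fixes L :: "'a::real_normed_vector \<Rightarrow> real"
  assumes "bounded_linear L" "(g has_vector_derivative g') (at t)"
  shows "((\<lambda>t. L (g t)) has_real_derivative L g') (at t)"
  unfolding has_real_derivative_iff_has_vector_derivative
  by (rule bounded_linear.has_vector_derivative[OF assms])

lemma Re_trace_tangent:
  assumes "\<And>t. pd_state (\<sigma> t)" "(\<sigma> has_vector_derivative J) (at 0)"
  shows "Re (trace J) = 0"
proof -
  have "((\<lambda>t. Re (trace (\<sigma> t))) has_real_derivative Re (trace J)) (at 0)"
    by (rule bounded_linear_has_real_derivative[OF bounded_linear_Re_trace assms(2)])
  then have "((\<lambda>t. 1) has_real_derivative Re (trace J)) (at 0)"
    using assms(1) by (simp add: pd_state_def)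
  then show ?thesis
    using DERIV_unique DERIV_const by blast
qed

text \<open>The inner derivative is in \<open>t\<close>, the outer one in \<open>s\<close>.
  \<open>J s\<close> is the velocity in \<open>t\<close> along \<open>t = 0\<close>; the result
  contains only \<open>K\<close> and \<open>J 0\<close>, the two tangent vectors at the base
  point.\<close>

lemma rel_entropy_mixed_derivative:
  fixes R :: "real \<Rightarrow> real \<Rightarrow> complex^'n^'n"
  assumes state: "\<And>s t. pd_state (R s t)"
    and dt: "\<And>s. (R s has_vector_derivative J s) (at 0)"
    and ds: "((\<lambda>s. R s 0) has_vector_derivative K) (at 0)"
    and J: "(J \<longlongrightarrow> J 0) (at 0)"
  shows "((\<lambda>s. deriv (\<lambda>t. rel_entropy (R 0 0) (R s t)) 0) has_real_derivative
      Re (trace (K ** mat_deriv diff_ln (R 0 0) (J 0)))) (at 0)"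
proof -
  define \<rho> where "\<rho> = R 0 0"
  have pd: "positive_definite (R s t)" for s t
    using state by (simp add: pd_state_def)
  define G where "G s = mat_deriv diff_ln (R s 0) (J s)" for s
  have "((\<lambda>t. rel_entropy \<rho> (R s t)) has_real_derivative Re (trace ((R s 0 - \<rho>) ** G s))) (at 0)" for s
  proof -
    have "((\<lambda>t. \<rho> ** (mat_ln \<rho> - mat_ln (R s t))) has_vector_derivative \<rho> ** (0 - G s)) (at 0)"
      unfolding mat_ln_def G_def
      by (intro bounded_linear.has_vector_derivative[OF
            bounded_bilinear.bounded_linear_right[OF bounded_bilinear_matrix_mult]]
          has_vector_derivative_diff has_vector_derivative_const
          has_vector_derivative_mat_fun[OF dt pd locally_lipschitz_pos_diff_ln])
    from bounded_linear_has_real_derivative[OF bounded_linear_Re_trace this]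
    have "((\<lambda>t. rel_entropy \<rho> (R s t)) has_real_derivative Re (trace (\<rho> ** (0 - G s)))) (at 0)"
      by (simp add: rel_entropy_def)
    moreover have "Re (trace (R s 0 ** G s)) = 0"
      unfolding G_def trace_mult_mat_deriv_ln[OF pd] using Re_trace_tangent[OF state dt] .
    moreover have "Re (trace (\<rho> ** (0 - G s))) = - Re (trace (\<rho> ** G s))"
      by (simp add: bounded_bilinear.minus_right[OF bounded_bilinear_matrix_mult] trace_def sum_negf)
    ultimately show ?thesis
      by (simp add: matrix_diff_rdistrib trace_sub)
  qed
  then have "(\<lambda>s. deriv (\<lambda>t. rel_entropy \<rho> (R s t)) 0) = (\<lambda>s. Re (trace ((R s 0 - \<rho>) ** G s)))"
    using DERIV_imp_deriv by blast
  moreover have "((\<lambda>s. Re (trace ((R s 0 - \<rho>) ** G s))) has_real_derivative Re (trace (K ** G 0))) (at 0)"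
  proof (rule has_real_derivative_trace_mult)
    show "((\<lambda>s. R s 0 - \<rho>) has_vector_derivative K) (at 0)"
      using has_vector_derivative_diff[OF ds has_vector_derivative_const] by simp
    show "(G \<longlongrightarrow> G 0) (at 0)"
      unfolding G_def
      by (rule tendsto_mat_deriv[OF pd locally_lipschitz_pos_diff_ln pd _ J])
        (use has_vector_derivative_continuous[OF ds] in \<open>simp add: continuous_at\<close>)
  qed (simp add: \<rho>_def)
  ultimately show ?thesis
    by (simp add: \<rho>_def G_def)
qed

text \<open>Below, \<open>X\<close> is the inner operator of the divergence, \<open>T\<close> its
  outer factor and \<open>W\<close> the power of \<open>X\<close> produced by differentiating the
  trace. At the base point \<open>T\<close> and \<open>W\<close> equal \<open>S\<close> and
  \<open>Y\<close>, and their \<open>s\<close>-derivatives are \<open>S1\<close> and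
  \<open>Y1\<close>.\<close>

lemma alpha_z_div_mixed_derivative:
  fixes R :: "real \<Rightarrow> real \<Rightarrow> complex^'n^'n" and \<alpha> z :: real
  assumes state: "\<And>s t. pd_state (R s t)"
    and dt: "\<And>s. (R s has_vector_derivative J s) (at 0)"
    and ds: "((\<lambda>s. R s 0) has_vector_derivative K) (at 0)"
    and J: "(J \<longlongrightarrow> J 0) (at 0)"
    and z: "z > 0"
  defines "q \<equiv> (1 - \<alpha>) / (2 * z)"
  defines "\<rho> \<equiv> R 0 0"
  defines "A \<equiv> mat_powr \<rho> (\<alpha> / z)"
  defines "S \<equiv> mat_powr \<rho> q" and "S1 \<equiv> mat_deriv (diff_powr q) \<rho> K"
  defines "Y \<equiv> mat_powr \<rho> ((z - 1) / z)"
    and "Y1 \<equiv> mat_deriv (diff_powr (z - 1)) (mat_powr \<rho> (1 / z)) (S ** A ** S1 + S1 ** A ** S)"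
  shows "((\<lambda>s. deriv (\<lambda>t. alpha_z_div \<alpha> z \<rho> (R s t)) 0) has_real_derivative
      z / (\<alpha> - 1) * Re (trace ((A ** S ** Y1 + A ** S1 ** Y + (Y ** S1 ** A + Y1 ** S ** A) -
        2 *\<^sub>R mat_deriv (diff_powr (1 - q)) \<rho> K) ** mat_deriv (diff_powr q) \<rho> (J 0)))) (at 0)"
proof -
  have pd: "positive_definite (R s t)" for s t
    using state by (simp add: pd_state_def)
  have A: "positive_definite A"
    unfolding A_def \<rho>_def by (intro positive_definite_mat_powr pd)
  define T where "T s t = mat_powr (R s t) q" for s t
  define X where "X s t = T s t ** A ** T s t" for s t
  define W where "W s t = mat_powr (X s t) (z - 1)" for s t
  define Q where "Q s t = Re (trace (mat_powr (X s t) z))" for s t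
  define G where "G s = mat_deriv (diff_powr q) (R s 0) (J s)" for s
  \<comment> \<open>The first two terms arise from the derivative of the trace by cyclicity. The
    last one has real trace 0 against \<open>G s\<close> and cancels the others at
    \<open>s = 0\<close>.\<close>
  define P where "P s = A ** T s 0 ** W s 0 + W s 0 ** T s 0 ** A - 2 *\<^sub>R mat_powr (R s 0) (1 - q)" for s
  have X: "positive_definite (X s t)" for s t
    unfolding X_def T_def by (intro positive_definite_sandwich A positive_definite_mat_powr pd)
  have Qpos: "Q s t > 0" for s t
    unfolding Q_def by (intro trace_positive_definite_pos positive_definite_mat_powr X)
  have \<rho>: "positive_definite \<rho>" by (simp add: \<rho>_def pd)
  have T0: "T 0 0 = S" by (simp add: T_def S_def \<rho>_def)
  \<comment> \<open>Hence \<open>X 0 0\<close> is a power of \<rho> whose \<open>z\<close>-th power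
    is \<rho>, and \<open>Q 0 0 = 1\<close>.\<close>
  have "\<alpha> / z + q + q = 1 / z"
    using z by (simp add: q_def field_simps)
  then have X0: "X 0 0 = mat_powr \<rho> (1 / z)"
    unfolding X_def T0 unfolding S_def A_def by (simp add: mat_powr_mult[OF \<rho>] add_ac)
  have W0: "W 0 0 = Y"
    using z by (simp add: W_def X0 mat_powr_mat_powr[OF \<rho>] Y_def)
  have Q0: "Q 0 0 = 1"
    using z state[of 0 0]
    by (simp add: Q_def X0 mat_powr_mat_powr[OF \<rho>] mat_powr_one[OF \<rho>]) (simp add: \<rho>_def pd_state_def)
  have div: "alpha_z_div \<alpha> z \<rho> (R s t) = 1 / (\<alpha> - 1) * ln (Q s t)" for s t
    unfolding alpha_z_div_def Q_def X_def T_def A_def q_def ..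
  have dQ: "((\<lambda>t. Q s t) has_real_derivative z * Re (trace (P s ** G s))) (at 0)" for s
  proof -
    have T': "(T s has_vector_derivative G s) (at 0)"
      unfolding T_def G_def by (rule has_vector_derivative_mat_powr[OF dt pd])
    have "((\<lambda>t. T s t ** A) has_vector_derivative G s ** A) (at 0)"
      by (rule bounded_linear.has_vector_derivative[OF
            bounded_bilinear.bounded_linear_left[OF bounded_bilinear_matrix_mult] T'])
    from has_vector_derivative_matrix_mult[OF this T']
    have X': "(X s has_vector_derivative (T s 0 ** A ** G s + G s ** A ** T s 0)) (at 0)"
      unfolding X_def .
    have "((\<lambda>t. Q s t) has_real_derivative
        Re (trace (mat_deriv (diff_powr z) (X s 0) (T s 0 ** A ** G s + G s ** A ** T s 0)))) (at 0)"
      unfolding Q_def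
      by (rule bounded_linear_has_real_derivative[OF bounded_linear_Re_trace
            has_vector_derivative_mat_powr[OF X' X]])
    also have "trace (mat_deriv (diff_powr z) (X s 0) (T s 0 ** A ** G s + G s ** A ** T s 0)) =
        z *\<^sub>R trace (W s 0 ** (T s 0 ** A ** G s + G s ** A ** T s 0))"
    proof -
      have "mat_fun (\<lambda>x. z * x powr (z - 1)) (X s 0) = z *\<^sub>R W s 0"
      proof -
        obtain U d where U: "unitary_mat U" "X s 0 = U ** rdiag d ** cadj U"
          using positive_definite_diagonalization[OF X] by metis
        have "rdiag (\<lambda>i. z * d i powr (z - 1)) = z *\<^sub>R (rdiag (\<lambda>i. d i powr (z - 1)) :: complex^'n^'n)"
          by (auto simp: rdiag_def vec_eq_iff complex_eq_iff)
        then show ?thesis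
          by (simp add: W_def mat_powr_def U mat_fun_unitary_diag matrix_scaleR_ldistrib matrix_scaleR_rdistrib)
      qed
      then show ?thesis
        by (simp add: trace_mat_deriv[OF X] matrix_scaleR_rdistrib trace_scaleR)
    qed
    also have "trace (W s 0 ** (T s 0 ** A ** G s + G s ** A ** T s 0)) =
        trace ((A ** T s 0 ** W s 0 + W s 0 ** T s 0 ** A) ** G s)"
    proof -
      have "trace (W s 0 ** (G s ** A ** T s 0)) = trace (A ** T s 0 ** W s 0 ** G s)"
        using trace_mul_sym[of "W s 0 ** G s" "A ** T s 0"] by (simp add: matrix_mul_assoc)
      then show ?thesis
        by (simp add: matrix_add_ldistrib matrix_add_rdistrib trace_add matrix_mul_assoc)
    qed
    also have "Re (z *\<^sub>R trace ((A ** T s 0 ** W s 0 + W s 0 ** T s 0 ** A) ** G s)) =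
        z * Re (trace (P s ** G s))"
    proof -
      have "Re (trace (mat_powr (R s 0) (1 - q) ** G s)) = 0"
        unfolding G_def trace_mat_powr_mat_deriv_powr[OF pd] using Re_trace_tangent[OF state dt] by simp
      then show ?thesis
        by (simp add: P_def matrix_diff_rdistrib trace_sub matrix_scaleR_rdistrib trace_scaleR)
    qed
    finally show ?thesis .
  qed
  \<comment> \<open>The factor \<open>1 / Q s 0\<close> from the logarithm joins \<open>G\<close>,
    so that only its continuity at 0 is used.\<close>
  have "((\<lambda>t. alpha_z_div \<alpha> z \<rho> (R s t)) has_real_derivative
      z / (\<alpha> - 1) * Re (trace (P s ** ((1 / Q s 0) *\<^sub>R G s)))) (at 0)" for s
  proof -
    have "((\<lambda>t. 1 / (\<alpha> - 1) * ln (Q s t)) has_real_derivative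
        1 / (\<alpha> - 1) * (1 / Q s 0 * (z * Re (trace (P s ** G s))))) (at 0)"
      by (intro DERIV_cmult DERIV_chain2[OF DERIV_ln_divide[OF Qpos] dQ])
    then show ?thesis
      unfolding div by (simp add: matrix_scaleR_ldistrib trace_scaleR mult_ac)
  qed
  then have "(\<lambda>s. deriv (\<lambda>t. alpha_z_div \<alpha> z \<rho> (R s t)) 0) =
      (\<lambda>s. z / (\<alpha> - 1) * Re (trace (P s ** ((1 / Q s 0) *\<^sub>R G s))))"
    using DERIV_imp_deriv by blast
  moreover have "((\<lambda>s. z / (\<alpha> - 1) * Re (trace (P s ** ((1 / Q s 0) *\<^sub>R G s)))) has_real_derivative
      z / (\<alpha> - 1) * Re (trace ((A ** S ** Y1 + A ** S1 ** Y + (Y ** S1 ** A + Y1 ** S ** A) -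
        2 *\<^sub>R mat_deriv (diff_powr (1 - q)) \<rho> K) ** ((1 / Q 0 0) *\<^sub>R G 0)))) (at 0)"
  proof (intro DERIV_cmult has_real_derivative_trace_mult)
    \<comment> \<open>The exponents of \<open>A\<close>, \<open>S\<close> and \<open>Y\<close> add
      up to \<open>1 - q\<close>, which is the power subtracted in \<open>P\<close>.\<close>
    have e: "\<alpha> / z + q + (z - 1) / z = 1 - q"
      using z by (simp add: q_def field_simps)
    have "A ** S ** Y = mat_powr \<rho> (1 - q)" "Y ** S ** A = mat_powr \<rho> (1 - q)"
      unfolding A_def S_def Y_def e[symmetric] by (simp_all add: mat_powr_mult[OF \<rho>] add_ac)
    then show "P 0 = 0"
      by (simp add: P_def T0 W0 \<rho>_def[symmetric] scaleR_2)
    have T': "((\<lambda>s. T s 0) has_vector_derivative S1) (at 0)"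
      unfolding T_def S1_def \<rho>_def by (rule has_vector_derivative_mat_powr[OF ds pd])
    have TA': "((\<lambda>s. T s 0 ** A) has_vector_derivative S1 ** A) (at 0)"
      by (rule bounded_linear.has_vector_derivative[OF
            bounded_bilinear.bounded_linear_left[OF bounded_bilinear_matrix_mult] T'])
    have AT': "((\<lambda>s. A ** T s 0) has_vector_derivative A ** S1) (at 0)"
      by (rule bounded_linear.has_vector_derivative[OF
            bounded_bilinear.bounded_linear_right[OF bounded_bilinear_matrix_mult] T'])
    have X': "((\<lambda>s. X s 0) has_vector_derivative (S ** A ** S1 + S1 ** A ** S)) (at 0)"
      using has_vector_derivative_matrix_mult[OF TA' T'] unfolding X_def T0 .
    have W': "((\<lambda>s. W s 0) has_vector_derivative Y1) (at 0)"
      using has_vector_derivative_mat_powr[OF X' X, of "z - 1"] unfolding W_def Y1_def X0 .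
    have WTA': "((\<lambda>s. W s 0 ** T s 0 ** A) has_vector_derivative (Y ** S1 ** A + Y1 ** S ** A)) (at 0)"
      using has_vector_derivative_matrix_mult[OF W' TA'] unfolding W0 T0 matrix_mul_assoc .
    show "(P has_vector_derivative (A ** S ** Y1 + A ** S1 ** Y + (Y ** S1 ** A + Y1 ** S ** A) -
        2 *\<^sub>R mat_deriv (diff_powr (1 - q)) \<rho> K)) (at 0)"
      unfolding P_def
      using has_vector_derivative_matrix_mult[OF AT' W'] unfolding T0 W0
      by (intro has_vector_derivative_diff has_vector_derivative_add WTA'
          bounded_linear.has_vector_derivative[OF bounded_linear_scaleR_right]
          has_vector_derivative_mat_powr[OF ds pd, folded \<rho>_def])
    have "((\<lambda>s. Q s 0) has_vector_derivative Re (trace (mat_deriv (diff_powr z) (X 0 0)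
        (S ** A ** S1 + S1 ** A ** S)))) (at 0)"
      unfolding Q_def
      by (rule bounded_linear.has_vector_derivative[OF bounded_linear_Re_trace
            has_vector_derivative_mat_powr[OF X' X]])
    then have "((\<lambda>s. Q s 0) \<longlongrightarrow> Q 0 0) (at 0)"
      using has_vector_derivative_continuous by (metis continuous_at)
    moreover have "(G \<longlongrightarrow> G 0) (at 0)"
      unfolding G_def
      by (rule tendsto_mat_deriv[OF pd locally_lipschitz_pos_diff_powr pd _ J])
        (use has_vector_derivative_continuous[OF ds] in \<open>simp add: continuous_at\<close>)
    ultimately show "((\<lambda>s. (1 / Q s 0) *\<^sub>R G s) \<longlongrightarrow> (1 / Q 0 0) *\<^sub>R G 0) (at 0)"
      using Qpos[of 0 0] by (intro tendsto_scaleR tendsto_divide tendsto_const) auto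
  qed
  ultimately show ?thesis
    by (simp add: Q0 G_def \<rho>_def)
qed

section \<open>Limits of the scalar coefficients\<close>

lemma tendsto_powr_over_at_top:
  fixes x c :: real
  assumes "x > 0"
  shows "((\<lambda>z. x powr (c / z)) \<longlongrightarrow> 1) at_top"
  using assms by real_asymp

text \<open>With u = 1 / z, the quantity \<open>z * (x powr (c / z) - 1)\<close> is a difference
  quotient at 0 of u \<mapsto> \<open>x powr (c * u)\<close>.\<close>

lemma tendsto_powr_difference_at_top:
  fixes x y c :: real
  assumes "x > 0" "y > 0"
  shows "((\<lambda>z. z * (x powr (c / z) - y powr (c / z))) \<longlongrightarrow> c * (ln x - ln y)) at_top"
proof -
  have "((\<lambda>z. z * (x powr (c / z) - 1)) \<longlongrightarrow> c * ln x) at_top" if "x > 0" for x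
    using that by real_asymp
  from tendsto_diff[OF this[OF assms(1)] this[OF assms(2)]] show ?thesis
    by (simp add: algebra_simps)
qed

text \<open>Each difference of powers, scaled by \<open>z\<close>, is an \<open>N\<close> that tends
  to a multiple of \<open>ln x - ln y\<close>. The explicit factor \<open>z\<close> serves the first
  difference, and in the quotient of the other two the scaling cancels.\<close>

lemma zeta_alpha_z_tendsto:
  assumes x: "x > 0" and y: "y > 0" and xy: "x \<noteq> y" and \<alpha>: "\<alpha> \<noteq> 0" "\<alpha> \<noteq> 1"
  shows "((\<lambda>z. zeta_alpha_z \<alpha> z x y) \<longlongrightarrow> (ln x - ln y) / (x - y)) at_top"
proof -
  have ln: "ln x - ln y \<noteq> 0" using x y xy by simp
  define N where "N c z = z * (x powr (c / z) - y powr (c / z))" for c z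
  have N: "(N c \<longlongrightarrow> c * (ln x - ln y)) at_top" for c
    unfolding N_def by (rule tendsto_powr_difference_at_top[OF x y])
  have "((\<lambda>z. N (1 - \<alpha>) z / (\<alpha> * (1 - \<alpha>)) / (x - y) * (N \<alpha> z / N 1 z)) \<longlongrightarrow>
      (1 - \<alpha>) * (ln x - ln y) / (\<alpha> * (1 - \<alpha>)) / (x - y) * (\<alpha> * (ln x - ln y) / (1 * (ln x - ln y)))) at_top"
    using ln xy \<alpha> by (intro tendsto_intros N) auto
  moreover have "(1 - \<alpha>) * (ln x - ln y) / (\<alpha> * (1 - \<alpha>)) / (x - y) * (\<alpha> * (ln x - ln y) / (1 * (ln x - ln y)))
      = (ln x - ln y) / (x - y)"
    using ln xy \<alpha> by simp
  moreover have "\<forall>\<^sub>F z in at_top. N (1 - \<alpha>) z / (\<alpha> * (1 - \<alpha>)) / (x - y) * (N \<alpha> z / N 1 z) = zeta_alpha_z \<alpha> z x y"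
    using eventually_gt_at_top[of 0] by eventually_elim (simp add: N_def zeta_alpha_z_def)
  ultimately show ?thesis
    using tendsto_cong by fastforce
qed

text \<open>The weight of a matrix entry in the trace of
  \<open>alpha_z_div_mixed_derivative\<close>, in an eigenbasis and without the prefactors. The
  square arises because the symmetrized product with the powers of \<rho> occurs twice, inside
  \<open>Y1\<close> and around it.\<close>

definition alpha_z_coeff :: "real \<Rightarrow> real \<Rightarrow> real \<Rightarrow> real \<Rightarrow> real" where
  "alpha_z_coeff \<alpha> z x y = (let q = (1 - \<alpha>) / (2 * z) in
    ((x powr (\<alpha> / z) * x powr q + y powr (\<alpha> / z) * y powr q)\<^sup>2 *
        (diff_powr (z - 1) (x powr (1 / z)) (y powr (1 / z)) * diff_powr q x y) +
      diff_powr q x y * (x powr (\<alpha> / z) * y powr ((z - 1) / z) + x powr ((z - 1) / z) * y powr (\<alpha> / z)) -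
      2 * diff_powr (1 - q) x y) * diff_powr q y x)"

lemma tendsto_scaled_diff_powr:
  assumes "x > 0" "y > 0"
  shows "((\<lambda>z. z * diff_powr (c / z) x y) \<longlongrightarrow> c * diff_ln x y) at_top"
proof (cases "x = y")
  case True
  have "((\<lambda>z. c * x powr (c / z) / x) \<longlongrightarrow> c * 1 / x) at_top"
    using assms by (intro tendsto_intros tendsto_powr_over_at_top) auto
  moreover have "\<forall>\<^sub>F z in at_top. c * x powr (c / z) / x = z * diff_powr (c / z) x y"
    using eventually_gt_at_top[of 0]
    by eventually_elim (use True assms in \<open>simp add: divided_difference_def powr_diff\<close>)
  ultimately show ?thesis
    using True by (simp add: divided_difference_def tendsto_cong)
next
  case False
  have "((\<lambda>z. z * (x powr (c / z) - y powr (c / z)) / (x - y)) \<longlongrightarrow> c * (ln x - ln y) / (x - y)) at_top"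
    using assms False by (intro tendsto_divide tendsto_const tendsto_powr_difference_at_top) auto
  then show ?thesis
    using False by (simp add: divided_difference_def)
qed

lemma tendsto_diff_powr_zero:
  assumes "x > 0" "y > 0"
  shows "((\<lambda>z. diff_powr (c / z) x y) \<longlongrightarrow> 0) at_top"
proof -
  have "((\<lambda>z. (z * diff_powr (c / z) x y) * inverse z) \<longlongrightarrow> (c * diff_ln x y) * 0) at_top"
    by (intro tendsto_mult tendsto_scaled_diff_powr[OF assms] tendsto_inverse_0_at_top filterlim_ident)
  moreover have "\<forall>\<^sub>F z in at_top. (z * diff_powr (c / z) x y) * inverse z = diff_powr (c / z) x y"
    using eventually_gt_at_top[of 0] by eventually_elim simp
  ultimately show ?thesis
    unfolding mult_zero_right by (rule Lim_transform_eventually)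
qed

lemma tendsto_diff_powr_one:
  assumes "x > 0" "y > 0"
  shows "((\<lambda>z. diff_powr (1 - c / z) x y) \<longlongrightarrow> 1) at_top"
proof (cases "x = y")
  case True
  have "((\<lambda>z. (1 - c / z) * x powr (- c / z)) \<longlongrightarrow> (1 - 0) * 1) at_top"
    using assms by (intro tendsto_mult tendsto_diff tendsto_const tendsto_powr_over_at_top) real_asymp+
  then show ?thesis
    using True by (simp add: divided_difference_def)
next
  case False
  have pow: "((\<lambda>z. x powr (1 - c / z)) \<longlongrightarrow> x) at_top" if "x > 0" for x
    using that by real_asymp
  have "((\<lambda>z. (x powr (1 - c / z) - y powr (1 - c / z)) / (x - y)) \<longlongrightarrow> (x - y) / (x - y)) at_top"
    using False by (intro tendsto_divide tendsto_diff tendsto_const pow assms) simp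
  then show ?thesis
    using False by (simp add: divided_difference_def)
qed

text \<open>The first factor grows in general like \<open>z\<close> and the second decays like
  \<open>c / z\<close>, so they are treated together. By the chain rule for divided differences the
  product imitates that of a composition whose outer power tends to the identity.\<close>

lemma tendsto_diff_powr_chain:
  assumes x: "x > 0" and y: "y > 0"
  shows "((\<lambda>z. diff_powr (z - 1) (x powr (1 / z)) (y powr (1 / z)) * diff_powr (c / z) x y) \<longlongrightarrow> c) at_top"
proof (cases "x = y")
  case True
  \<comment> \<open>On the diagonal the derivative of the outer power at
    \<open>x powr (1 / z)\<close> has exponent \<open>z - 2\<close>, which becomes
    \<open>1 - 2 / z\<close> as a power of \<open>x\<close>.\<close>
  have "((\<lambda>z. (z - 1) / z * (x powr (-2 / z) * x * (c * x powr (c / z) / x))) \<longlongrightarrow> 1 * (1 * x * (c * 1 / x))) at_top"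
    using x by (intro tendsto_mult tendsto_divide tendsto_const tendsto_powr_over_at_top) (real_asymp | simp)+
  moreover have "\<forall>\<^sub>F z in at_top. (z - 1) / z * (x powr (-2 / z) * x * (c * x powr (c / z) / x)) =
      diff_powr (z - 1) (x powr (1 / z)) (y powr (1 / z)) * diff_powr (c / z) x y"
    using eventually_gt_at_top[of 0]
  proof eventually_elim
    fix z :: real assume z: "z > 0"
    have "1 / z * (z - 2) = -2 / z + 1" using z by (simp add: field_simps)
    then have "(x powr (1 / z)) powr (z - 2) = x powr (-2 / z) * x"
      using x by (simp only: powr_powr powr_add) simp
    moreover have "x powr (c / z - 1) = x powr (c / z) / x"
      using x by (simp add: powr_diff)
    ultimately show "(z - 1) / z * (x powr (-2 / z) * x * (c * x powr (c / z) / x)) =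
      diff_powr (z - 1) (x powr (1 / z)) (y powr (1 / z)) * diff_powr (c / z) x y"
      unfolding True[symmetric] divided_difference_def by simp
  qed
  ultimately show ?thesis
    using x by (simp add: tendsto_cong)
next
  case False
  have ln: "ln x - ln y \<noteq> 0" using x y False by simp
  define N where "N c z = z * (x powr (c / z) - y powr (c / z))" for c z
  have N: "(N c \<longlongrightarrow> c * (ln x - ln y)) at_top" for c
    unfolding N_def by (rule tendsto_powr_difference_at_top[OF x y])
  have pow: "((\<lambda>z. x powr (1 - 1 / z)) \<longlongrightarrow> x) at_top" if "x > 0" for x :: real
    using that by real_asymp
  have "((\<lambda>z. (x powr (1 - 1 / z) - y powr (1 - 1 / z)) / N 1 z * (N c z / (x - y))) \<longlongrightarrow>
      (x - y) / (1 * (ln x - ln y)) * (c * (ln x - ln y) / (x - y))) at_top"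
    using ln False by (intro tendsto_mult tendsto_divide tendsto_diff tendsto_const pow N x y) auto
  moreover have "(x - y) / (1 * (ln x - ln y)) * (c * (ln x - ln y) / (x - y)) = c"
    using ln False by simp
  moreover have "\<forall>\<^sub>F z in at_top. (x powr (1 - 1 / z) - y powr (1 - 1 / z)) / N 1 z * (N c z / (x - y)) =
      diff_powr (z - 1) (x powr (1 / z)) (y powr (1 / z)) * diff_powr (c / z) x y"
    using eventually_gt_at_top[of 0]
  proof eventually_elim
    fix z :: real assume z: "z > 0"
    \<comment> \<open>This selects the quotient branch of the divided difference.\<close>
    have "x powr (1 / z) \<noteq> y powr (1 / z)"
    proof
      assume "x powr (1 / z) = y powr (1 / z)"
      then have "(x powr (1 / z)) powr z = (y powr (1 / z)) powr z" by simp
      then show False using x y z False by (simp add: powr_powr)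
    qed
    moreover have "1 / z * (z - 1) = 1 - 1 / z" using z by (simp add: field_simps)
    then have "(x powr (1 / z)) powr (z - 1) = x powr (1 - 1 / z)" for x
      by (simp only: powr_powr)
    ultimately show "(x powr (1 - 1 / z) - y powr (1 - 1 / z)) / N 1 z * (N c z / (x - y)) =
      diff_powr (z - 1) (x powr (1 / z)) (y powr (1 / z)) * diff_powr (c / z) x y"
      using False z by (simp add: divided_difference_def N_def)
  qed
  ultimately show ?thesis
    using tendsto_cong by fastforce
qed

text \<open>With c = (1 - \<alpha>) / 2 the bracket tends to 4 c - 2 = - 2 \<alpha>, and the last
  factor scaled by \<open>z\<close> tends to c times \<open>diff_ln y x\<close>. The product of the
  constants is \<alpha> (\<alpha> - 1), which the prefactor cancels.\<close>

lemma alpha_z_coeff_tendsto: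
  assumes x: "x > 0" and y: "y > 0" and \<alpha>: "\<alpha> \<noteq> 0" "\<alpha> \<noteq> 1"
  shows "((\<lambda>z. z / (\<alpha> * (\<alpha> - 1)) * alpha_z_coeff \<alpha> z x y) \<longlongrightarrow> diff_ln y x) at_top"
proof -
  define c where "c = (1 - \<alpha>) / 2"
  have q: "(1 - \<alpha>) / (2 * z) = c / z" for z by (simp add: c_def)
  have p: "((\<lambda>z. x powr (c / z)) \<longlongrightarrow> 1) at_top" if "x > 0" for x c :: real
    using tendsto_powr_over_at_top[OF that] .
  have p1: "((\<lambda>z. x powr ((z - 1) / z)) \<longlongrightarrow> x) at_top" if "x > 0" for x :: real
    using that by real_asymp
  define B where "B z = (x powr (\<alpha> / z) * x powr (c / z) + y powr (\<alpha> / z) * y powr (c / z))\<^sup>2 *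
        (diff_powr (z - 1) (x powr (1 / z)) (y powr (1 / z)) * diff_powr (c / z) x y) +
      diff_powr (c / z) x y * (x powr (\<alpha> / z) * y powr ((z - 1) / z) + x powr ((z - 1) / z) * y powr (\<alpha> / z)) -
      2 * diff_powr (1 - c / z) x y" for z
  have "(B \<longlongrightarrow> (1 * 1 + 1 * 1)\<^sup>2 * c + 0 * (1 * y + x * 1) - 2 * 1) at_top"
    unfolding B_def
    by (intro tendsto_add tendsto_diff tendsto_mult tendsto_power tendsto_const p p1 x y
        tendsto_diff_powr_chain tendsto_diff_powr_zero tendsto_diff_powr_one)
  then have "((\<lambda>z. 1 / (\<alpha> * (\<alpha> - 1)) * (B z * (z * diff_powr (c / z) y x))) \<longlongrightarrow>
      1 / (\<alpha> * (\<alpha> - 1)) * (((1 * 1 + 1 * 1)\<^sup>2 * c + 0 * (1 * y + x * 1) - 2 * 1) * (c * diff_ln y x))) at_top"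
    by (intro tendsto_mult tendsto_const tendsto_scaled_diff_powr x y)
  moreover have "1 / (\<alpha> * (\<alpha> - 1)) * (((1 * 1 + 1 * 1)\<^sup>2 * c + 0 * (1 * y + x * 1) - 2 * 1) * (c * diff_ln y x))
      = diff_ln y x"
    using \<alpha> by (simp add: c_def field_simps)
  moreover have "z / (\<alpha> * (\<alpha> - 1)) * alpha_z_coeff \<alpha> z x y =
      1 / (\<alpha> * (\<alpha> - 1)) * (B z * (z * diff_powr (c / z) y x))" for z
    unfolding alpha_z_coeff_def Let_def q B_def[symmetric] by simp
  ultimately show ?thesis by (simp only:)
qed

section \<open>The information matrices in an eigenbasis\<close>

lemma trace_mult_eq_sum: "trace (M ** N) = (\<Sum>k\<in>UNIV. \<Sum>l\<in>UNIV. M $ k $ l * N $ l $ k)"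
  by (simp add: trace_def matrix_matrix_mult_def)

lemma rel_entropy_eigenbasis:
  fixes U Kh Jh :: "complex^'n^'n"
  assumes U: "unitary_mat U"
  shows "Re (trace ((U ** Kh ** cadj U) ** mat_deriv diff_ln (U ** rdiag d ** cadj U) (U ** Jh ** cadj U))) =
    (\<Sum>k\<in>UNIV. \<Sum>l\<in>UNIV. diff_ln (d l) (d k) * Re (Kh $ k $ l * Jh $ l $ k))"
proof -
  have cancel: "cadj U ** (U ** X ** cadj U) ** U = X"
    "(U ** X ** cadj U) ** (U ** Y ** cadj U) = U ** (X ** Y) ** cadj U" for X Y
    by (simp_all add: cancel_cadj_unitary[OF U] unitary_matD(1)[OF U] flip: matrix_mul_assoc)
  show ?thesis
    unfolding mat_deriv_unitary_diag[OF U] double_op_def cancel trace_unitary_conj[OF U]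
    unfolding trace_mult_eq_sum by (simp add: algebra_simps)
qed

text \<open>One \<open>U\<close> diagonalizes \<rho> and all its powers, so powers act as diagonal
  matrices and derivatives as entrywise multipliers. None of them mixes entries, so the trace
  becomes a weighted sum over pairs.\<close>

lemma alpha_z_eigenbasis:
  fixes U Kh Jh :: "complex^'n^'n" and d :: "'n \<Rightarrow> real" and \<alpha> z :: real
  assumes U: "unitary_mat U"
  defines "q \<equiv> (1 - \<alpha>) / (2 * z)"
  defines "\<rho> \<equiv> U ** rdiag d ** cadj U" and "K \<equiv> U ** Kh ** cadj U" and "J \<equiv> U ** Jh ** cadj U"
  defines "A \<equiv> mat_powr \<rho> (\<alpha> / z)"
  defines "S \<equiv> mat_powr \<rho> q" and "S1 \<equiv> mat_deriv (diff_powr q) \<rho> K"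
  defines "Y \<equiv> mat_powr \<rho> ((z - 1) / z)"
    and "Y1 \<equiv> mat_deriv (diff_powr (z - 1)) (mat_powr \<rho> (1 / z)) (S ** A ** S1 + S1 ** A ** S)"
  shows "Re (trace ((A ** S ** Y1 + A ** S1 ** Y + (Y ** S1 ** A + Y1 ** S ** A) -
        2 *\<^sub>R mat_deriv (diff_powr (1 - q)) \<rho> K) ** mat_deriv (diff_powr q) \<rho> J)) =
    (\<Sum>k\<in>UNIV. \<Sum>l\<in>UNIV. alpha_z_coeff \<alpha> z (d k) (d l) * Re (Kh $ k $ l * Jh $ l $ k))"
proof -
  define cj where "cj X = U ** X ** cadj U" for X
  define schur where "schur F e M = (\<chi> k l. complex_of_real (F (e k) (e l)) * M $ k $ l)"
    for F and e :: "'n \<Rightarrow> real" and M :: "complex^'n^'n"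
  have cancel: "cadj U ** cj X ** U = X" for X
    unfolding cj_def
    by (simp add: cancel_cadj_unitary[OF U] unitary_matD(1)[OF U] flip: matrix_mul_assoc)
  have mul: "cj X ** cj Y = cj (X ** Y)" for X Y
    unfolding cj_def by (simp add: cancel_cadj_unitary[OF U] flip: matrix_mul_assoc)
  have lin: "cj X + cj Y = cj (X + Y)" "cj X - cj Y = cj (X - Y)" "r *\<^sub>R cj X = cj (r *\<^sub>R X)" for X Y r
    by (simp_all add: cj_def matrix_add_ldistrib matrix_add_rdistrib matrix_diff_ldistrib
        matrix_diff_rdistrib matrix_scaleR_ldistrib matrix_scaleR_rdistrib)
  have powr: "mat_powr (cj (rdiag e)) s = cj (rdiag (\<lambda>i. e i powr s))" for e s
    unfolding cj_def mat_powr_def by (rule mat_fun_unitary_diag[OF U])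
  have deriv: "mat_deriv F (cj (rdiag e)) (cj M) = cj (schur F e M)" for F e M
    unfolding cj_def[of "rdiag e"] mat_deriv_unitary_diag[OF U] double_op_def cancel
    by (simp add: cj_def schur_def)
  have trace: "trace (cj X) = trace X" for X
    unfolding cj_def by (rule trace_unitary_conj[OF U])
  note folds = cj_def[symmetric]
  define DA where "DA = rdiag (\<lambda>i. d i powr (\<alpha> / z))"
  define DS where "DS = rdiag (\<lambda>i. d i powr q)"
  define DY where "DY = rdiag (\<lambda>i. d i powr ((z - 1) / z))"
  define M1 where "M1 = schur (diff_powr q) d Kh"
  define N1 where "N1 = schur (diff_powr (z - 1)) (\<lambda>i. d i powr (1 / z)) (DS ** DA ** M1 + M1 ** DA ** DS)"
  have "Re (trace ((A ** S ** Y1 + A ** S1 ** Y + (Y ** S1 ** A + Y1 ** S ** A) -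
        2 *\<^sub>R mat_deriv (diff_powr (1 - q)) \<rho> K) ** mat_deriv (diff_powr q) \<rho> J)) =
      Re (trace ((DA ** DS ** N1 + DA ** M1 ** DY + (DY ** M1 ** DA + N1 ** DS ** DA) -
        2 *\<^sub>R schur (diff_powr (1 - q)) d Kh) ** schur (diff_powr q) d Jh))"
    unfolding Y1_def Y_def S1_def S_def A_def \<rho>_def K_def J_def folds powr deriv mul lin trace
    unfolding DA_def DS_def DY_def M1_def N1_def ..
  also have "\<dots> = (\<Sum>k\<in>UNIV. \<Sum>l\<in>UNIV. alpha_z_coeff \<alpha> z (d k) (d l) * Re (Kh $ k $ l * Jh $ l $ k))"
  proof -
    have entry: "(DA ** DS ** N1 + DA ** M1 ** DY + (DY ** M1 ** DA + N1 ** DS ** DA) -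
        2 *\<^sub>R schur (diff_powr (1 - q)) d Kh) $ k $ l * schur (diff_powr q) d Jh $ l $ k =
      of_real (alpha_z_coeff \<alpha> z (d k) (d l)) * (Kh $ k $ l * Jh $ l $ k)" for k l
    proof -
      define a s y where "a i = d i powr (\<alpha> / z)" and "s i = d i powr q" and "y i = d i powr ((z - 1) / z)"
        for i
      define f g h f' where "f = diff_powr q (d k) (d l)"
        and "g = diff_powr (z - 1) (d k powr (1 / z)) (d l powr (1 / z))"
        and "h = diff_powr (1 - q) (d k) (d l)" and "f' = diff_powr q (d l) (d k)"
      have M: "M1 $ k $ l = of_real f * Kh $ k $ l"
        by (simp add: M1_def schur_def f_def)
      have rd: "(DA ** X) $ i $ j = of_real (a i) * X $ i $ j" "(X ** DA) $ i $ j = X $ i $ j * of_real (a j)"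
        "(DS ** X) $ i $ j = of_real (s i) * X $ i $ j" "(X ** DS) $ i $ j = X $ i $ j * of_real (s j)"
        "(DY ** X) $ i $ j = of_real (y i) * X $ i $ j" "(X ** DY) $ i $ j = X $ i $ j * of_real (y j)"
        for X i j
        by (simp_all add: DA_def DS_def DY_def rdiag_mult_left rdiag_mult_right a_def s_def y_def)
      have N: "N1 $ k $ l = of_real g * (of_real (s k) * (of_real (a k) * M1 $ k $ l) +
          M1 $ k $ l * of_real (a l) * of_real (s l))"
        by (simp add: N1_def schur_def g_def vector_add_component rd flip: matrix_mul_assoc)
          (simp add: rd matrix_mul_assoc)
      have "(DA ** DS ** N1 + DA ** M1 ** DY + (DY ** M1 ** DA + N1 ** DS ** DA) -
          2 *\<^sub>R schur (diff_powr (1 - q)) d Kh) $ k $ l * schur (diff_powr q) d Jh $ l $ k =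
        (of_real (a k) * (of_real (s k) * N1 $ k $ l) + of_real (a k) * M1 $ k $ l * of_real (y l) +
         (of_real (y k) * M1 $ k $ l * of_real (a l) + N1 $ k $ l * of_real (s l) * of_real (a l)) -
         2 * (of_real h * Kh $ k $ l)) * (of_real f' * Jh $ l $ k)"
        \<comment> \<open>Only \<open>DA ** DS ** N1\<close> needs regrouping, so that its diagonal
          factors act from the left one by one.\<close>
        unfolding vector_minus_component vector_add_component vector_scaleR_component
        by (subst (1) matrix_mul_assoc[symmetric])
          (simp only: rd, simp add: schur_def h_def f'_def scaleR_conv_of_real)
      also have "\<dots> = of_real ((((a k * s k + a l * s l)\<^sup>2 * (g * f) + f * (a k * y l + y k * a l) - 2 * h) * f')) *
          (Kh $ k $ l * Jh $ l $ k)"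
        unfolding N M by (simp add: algebra_simps power2_eq_square)
      also have "((a k * s k + a l * s l)\<^sup>2 * (g * f) + f * (a k * y l + y k * a l) - 2 * h) * f' =
          alpha_z_coeff \<alpha> z (d k) (d l)"
        unfolding alpha_z_coeff_def Let_def a_def s_def y_def f_def g_def h_def f'_def q_def ..
      finally show ?thesis .
    qed
    have "Re (of_real c * w) = c * Re w" for c w by simp
    then show ?thesis
      unfolding trace_mult_eq_sum entry Re_sum by simp
  qed
  finally show ?thesis .
qed

text \<open>Both information matrices are finite sums over the same products of tangent entries in
  an eigenbasis of \<open>\<rho> \<theta>\<close>; only the weights differ, and these converge pair
  by pair.\<close>

lemma alpha_z_info_tendsto:
  fixes \<rho> :: "real^'l \<Rightarrow> complex^'n^'n"
  assumes diff: "twice_differentiable \<rho>" and state: "\<And>\<theta>. pd_state (\<rho> \<theta>)" and \<alpha>: "\<alpha> \<noteq> 0" "\<alpha> \<noteq> 1"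
  shows "((\<lambda>z. alpha_z_info \<alpha> z \<rho> \<theta>) \<longlongrightarrow> kubo_mori_info \<rho> \<theta>) at_top"
proof -
  obtain \<rho>' where \<rho>': "\<And>x. (\<rho> has_derivative blinfun_apply (\<rho>' x)) (at x)"
    and \<rho>'': "\<And>x. \<rho>' differentiable (at x)"
    using diff unfolding twice_differentiable_def by blast
  obtain U d where U: "unitary_mat U" and \<rho>d: "\<rho> \<theta> = U ** rdiag d ** cadj U" and d: "\<And>i. d i > 0"
    using positive_definite_diagonalization state pd_state_def by metis
  define E :: "'l \<Rightarrow> complex^'n^'n" where "E i = cadj U ** \<rho>' \<theta> (axis i 1) ** U" for i
  have E: "\<rho>' \<theta> (axis i 1) = U ** E i ** cadj U" for i
    unfolding E_def by (metis U cancel_cadj_unitary(2,4) matrix_mul_assoc)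
  have line: "((\<lambda>t. \<rho> (\<theta> + (v + t *\<^sub>R w))) has_vector_derivative \<rho>' (\<theta> + v) w) (at 0)" for v w
  proof -
    have "((\<lambda>t::real. \<theta> + (v + t *\<^sub>R w)) has_derivative (\<lambda>h. h *\<^sub>R w)) (at 0)"
      by (auto intro!: derivative_eq_intros)
    moreover have "(\<rho> has_derivative \<rho>' (\<theta> + v)) (at (\<theta> + (v + 0 *\<^sub>R w)))"
      using \<rho>' by simp
    ultimately have "(\<rho> \<circ> (\<lambda>t::real. \<theta> + (v + t *\<^sub>R w)) has_derivative \<rho>' (\<theta> + v) \<circ> (\<lambda>h. h *\<^sub>R w)) (at 0)"
      by (rule diff_chain_at)
    then show ?thesis
      by (simp add: has_vector_derivative_def o_def blinfun.scaleR_right)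
  qed
  note mixed = rel_entropy_mixed_derivative alpha_z_div_mixed_derivative
  have main: "alpha_z_info \<alpha> z \<rho> \<theta> $ i $ j = (\<Sum>k\<in>UNIV. \<Sum>l\<in>UNIV.
        z / (\<alpha> * (\<alpha> - 1)) * alpha_z_coeff \<alpha> z (d k) (d l) * Re (E i $ k $ l * E j $ l $ k))"
    "kubo_mori_info \<rho> \<theta> $ i $ j = (\<Sum>k\<in>UNIV. \<Sum>l\<in>UNIV.
        diff_ln (d l) (d k) * Re (E i $ k $ l * E j $ l $ k))"
    if z: "z > 0" for z i j
  proof -
    \<comment> \<open>\<open>s\<close> is the outer direction \<open>i\<close> and \<open>t\<close>
      the inner direction \<open>j\<close>; the leading 0 is the point at which the outer partial
      derivative is taken.\<close>
    define R where "R s t = \<rho> (\<theta> + (0 + s *\<^sub>R axis i 1 + t *\<^sub>R axis j 1))" for s t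
    define J where "J s = blinfun_apply (\<rho>' (\<theta> + s *\<^sub>R axis i 1)) (axis j 1)" for s :: real
    have st: "\<And>s t. pd_state (R s t)" by (simp add: R_def state)
    have dt: "\<And>s. (R s has_vector_derivative J s) (at 0)"
      unfolding R_def J_def using line[of "_ *\<^sub>R axis i 1" "axis j 1"] by simp
    have ds: "((\<lambda>s. R s 0) has_vector_derivative \<rho>' \<theta> (axis i 1)) (at 0)"
      unfolding R_def using line[of 0 "axis i 1"] by simp
    \<comment> \<open>Differentiability of the first derivative gives the continuity required of
      \<open>J\<close>.\<close>
    have "isCont \<rho>' \<theta>"
      using \<rho>'' differentiable_imp_continuous_within by blast
    then have "isCont (\<lambda>s::real. \<rho>' (\<theta> + s *\<^sub>R axis i 1)) 0"
      using isCont_o2[of 0 "\<lambda>s. \<theta> + s *\<^sub>R axis i 1" \<rho>'] by simp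
    then have "isCont J 0"
      unfolding J_def by (intro continuous_intros)
    then have J: "(J \<longlongrightarrow> J 0) (at 0)"
      by (simp add: continuous_at)
    have R0: "R 0 0 = U ** rdiag d ** cadj U" and J0: "J 0 = U ** E j ** cadj U"
      by (simp_all add: R_def J_def \<rho>d E)
    have R00: "R 0 0 = \<rho> \<theta>" by (simp add: R_def)
    show "kubo_mori_info \<rho> \<theta> $ i $ j = (\<Sum>k\<in>UNIV. \<Sum>l\<in>UNIV.
        diff_ln (d l) (d k) * Re (E i $ k $ l * E j $ l $ k))"
      using DERIV_imp_deriv[OF mixed(1)[OF st dt ds J]]
      unfolding J0 E unfolding R0 rel_entropy_eigenbasis[OF U]
      by (simp add: kubo_mori_info_def partial_deriv_def R_def \<rho>d)
    show "alpha_z_info \<alpha> z \<rho> \<theta> $ i $ j = (\<Sum>k\<in>UNIV. \<Sum>l\<in>UNIV.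
        z / (\<alpha> * (\<alpha> - 1)) * alpha_z_coeff \<alpha> z (d k) (d l) * Re (E i $ k $ l * E j $ l $ k))"
      using DERIV_imp_deriv[OF mixed(2)[OF st dt ds J z, of \<alpha>]]
      unfolding J0 E unfolding R0 alpha_z_eigenbasis[OF U]
      by (simp add: alpha_z_info_def partial_deriv_def R_def \<rho>d sum_distrib_left sum_divide_distrib mult_ac)
  qed
  have "((\<lambda>z. alpha_z_info \<alpha> z \<rho> \<theta> $ i $ j) \<longlongrightarrow> kubo_mori_info \<rho> \<theta> $ i $ j) at_top" for i j
  proof -
    have "((\<lambda>z. \<Sum>k\<in>UNIV. \<Sum>l\<in>UNIV.
        z / (\<alpha> * (\<alpha> - 1)) * alpha_z_coeff \<alpha> z (d k) (d l) * Re (E i $ k $ l * E j $ l $ k)) \<longlongrightarrow>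
        (\<Sum>k\<in>UNIV. \<Sum>l\<in>UNIV. diff_ln (d l) (d k) * Re (E i $ k $ l * E j $ l $ k))) at_top"
      by (intro tendsto_sum tendsto_mult_right alpha_z_coeff_tendsto d \<alpha>)
    moreover have "\<forall>\<^sub>F z in at_top. (\<Sum>k\<in>UNIV. \<Sum>l\<in>UNIV.
        z / (\<alpha> * (\<alpha> - 1)) * alpha_z_coeff \<alpha> z (d k) (d l) * Re (E i $ k $ l * E j $ l $ k)) =
        alpha_z_info \<alpha> z \<rho> \<theta> $ i $ j"
      using eventually_gt_at_top[of 0] by eventually_elim (simp only: main(1))
    ultimately show ?thesis
      \<comment> \<open>The Kubo-Mori formula was obtained for positive \<open>z\<close> but does
        not contain it; it is instantiated at 1.\<close>
      unfolding main(2)[OF zero_less_one] by (rule Lim_transform_eventually)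
  qed
  then show ?thesis
    by (intro vec_tendstoI)
qed

theorem proposition15:
  shows "(\<forall>x y \<alpha> :: real. x > 0 \<longrightarrow> y > 0 \<longrightarrow> x \<noteq> y \<longrightarrow> \<alpha> \<in> {0<..<1} \<union> {1<..} \<longrightarrow>
            ((\<lambda>z. zeta_alpha_z \<alpha> z x y) \<longlongrightarrow> (ln x - ln y) / (x - y)) at_top)
       \<and> (\<forall>(\<rho> :: real^'l \<Rightarrow> complex^'n^'n) (\<alpha> :: real) \<theta>.
            twice_differentiable \<rho> \<longrightarrow> (\<forall>\<theta>'. pd_state (\<rho> \<theta>')) \<longrightarrow> \<alpha> \<in> {0<..<1} \<union> {1<..} \<longrightarrow>
            ((\<lambda>z. alpha_z_info \<alpha> z \<rho> \<theta>) \<longlongrightarrow> kubo_mori_info \<rho> \<theta>) at_top)"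
proof (intro conjI allI impI)
  fix x y \<alpha> :: real
  assume "x > 0" "y > 0" "x \<noteq> y" "\<alpha> \<in> {0<..<1} \<union> {1<..}"
  then show "((\<lambda>z. zeta_alpha_z \<alpha> z x y) \<longlongrightarrow> (ln x - ln y) / (x - y)) at_top"
    by (intro zeta_alpha_z_tendsto) auto
next
  fix \<rho> :: "real^'l \<Rightarrow> complex^'n^'n" and \<alpha> :: real and \<theta>
  assume "twice_differentiable \<rho>" "\<forall>\<theta>'. pd_state (\<rho> \<theta>')" "\<alpha> \<in> {0<..<1} \<union> {1<..}"
  then show "((\<lambda>z. alpha_z_info \<alpha> z \<rho> \<theta>) \<longlongrightarrow> kubo_mori_info \<rho> \<theta>) at_top"
    by (intro alpha_z_info_tendsto) auto
qed

end
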